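(* The calculus $\{\lambda j,{\tt u}\}/{\tt obox}$ enjoys PSN: every $\lambda$-term that is $\beta$-strongly normalizing is strongly normalizing for $\to_{\{\lambda j,{\tt u}\}/{\tt obox}}$.
   Context: $\lambda j$-terms are generated by $t,u::= x\mid \lambda x.t\mid t\,u\mid t[x/u]$; $\lambda x.t$ and $t[x/u]$ bind $x$ in $t$ (not in $u$), and terms are considered modulo $\alpha$-conversion. $\lambda$-terms are those without jumps. $\mathrm{fv}(t)$ is the set of free variables, $t\{x/u\}$ is capture-avoiding meta-level substitution, and $|t|_x$ is the number of free occurrences of $x$ in $t$. If $|t|_x=n\ge2$, $t_{[y]_x}$ denotes any term obtained from $t$ by replacing $k$ of the free occurrences of $x$ by a fresh variable $y$, for some $1\le k\le n-1$. ${\tt L}$ denotes a (possibly empty) list of jumps $[x_1/u_1]\dots[x_k/u_k]$. Contexts: $C::=\Box\mid C\,v\mid v\,C\mid v[y/C]\mid C[y/v]\mid \lambda y.C$; boxed contexts: $B::= t\,C\mid t[x/C]\mid B\,t\mid B[x/t]\mid\lambda y.B$. The rewriting rules, closed under all contexts, are: $({\tt dB})$ $(\lambda x.t){\tt L}\,u\to t[x/u]{\tt L}$ where no $x_i$ of ${\tt L}$ is free in $u$; $({\tt w})$ $t[x/u]\to t$ if $|t|_x=0$; $({\tt d})$ $t[x/u]\to t\{x/u\}$ if $|t|_x=1$; $({\tt c})$ $t[x/u]\to t_{[y]_x}[x/u][y/u]$ if $|t|_x\ge2$, $y$ fresh; $({\tt u})$ $B[t[x/u]]\to B[t][x/u]$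 if $B$ binds no free variable of $u$ and $x\notin\mathrm{fv}(t)$. $\to_{\{\lambda j,{\tt u}\}}$ is the union of these five. The substitution equivalence $\equiv_{\tt obox}$ is the smallest equivalence closed under contexts containing: $t[x/s][y/v]\sim t[y/v][x/s]$ if $x\notin\mathrm{fv}(v)$ and $y\notin\mathrm{fv}(s)$; $\lambda y.(t[x/s])\sim(\lambda y.t)[x/s]$ if $y\notin\mathrm{fv}(s)$; $t[x/s]\,v\sim(t\,v)[x/s]$ if $x\notin\mathrm{fv}(v)$; $(t\,v)[x/u]\sim t\,(v[x/u])$ if $x\notin\mathrm{fv}(t)$ and $x\in\mathrm{fv}(v)$; $t[y/v][x/u]\sim t[y/v[x/u]]$ if $x\notin\mathrm{fv}(t)$ and $x\in\mathrm{fv}(v)$. Reduction modulo: $t\to_{\mathcal R/{\tt obox}}u$ iff $t\equiv_{\tt obox}t'\to_{\mathcal R}u'\equiv_{\tt obox}u$. $\beta$-reduction is the contextual closure of $(\lambda x.t)u\to t\{x/u\}$. *)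

theory Defs
  imports Main
begin

text \<open>lambda-j terms with de Bruijn indices (terms modulo alpha-conversion).
  Sub t u represents t[x/u]: index 0 of t is the bound variable x, u is not in its scope.\<close>

datatype jt = Var nat | Lam jt | App jt jt | Sub jt jt

fun shift :: "nat \<Rightarrow> nat \<Rightarrow> jt \<Rightarrow> jt" where
  "shift n c (Var i) = (if i < c then Var i else Var (i + n))"
| "shift n c (Lam t) = Lam (shift n (Suc c) t)"
| "shift n c (App t u) = App (shift n c t) (shift n c u)"
| "shift n c (Sub t u) = Sub (shift n (Suc c) t) (shift n c u)"

text \<open>subst t c u: capture-avoiding replacement of index c by u (u given in the frame
  outside the binder of c), decrementing the indices above c\<close>
fun subst :: "jt \<Rightarrow> nat \<Rightarrow> jt \<Rightarrow> jt" where
  "subst (Var i) c u = (if i < c then Var i else if i = c then shift c 0 u else Var (i - 1))"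
| "subst (Lam t) c u = Lam (subst t (Suc c) u)"
| "subst (App t s) c u = App (subst t c u) (subst s c u)"
| "subst (Sub t s) c u = Sub (subst t (Suc c) u) (subst s c u)"

text \<open>down c t: remove the (non-occurring) index c, decrementing the indices above c\<close>
fun down :: "nat \<Rightarrow> jt \<Rightarrow> jt" where
  "down c (Var i) = (if i < c then Var i else Var (i - 1))"
| "down c (Lam t) = Lam (down (Suc c) t)"
| "down c (App t u) = App (down c t) (down c u)"
| "down c (Sub t u) = Sub (down (Suc c) t) (down c u)"

fun occ :: "nat \<Rightarrow> jt \<Rightarrow> nat" where
  "occ c (Var i) = (if i = c then 1 else 0)"
| "occ c (Lam t) = occ (Suc c) t"
| "occ c (App t u) = occ c t + occ c u"
| "occ c (Sub t u) = occ (Suc c) t + occ c u"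

fun swap :: "nat \<Rightarrow> jt \<Rightarrow> jt" where
  "swap c (Var i) = (if i = c then Var (Suc c) else if i = Suc c then Var c else Var i)"
| "swap c (Lam t) = Lam (swap (Suc c) t)"
| "swap c (App t u) = App (swap c t) (swap c u)"
| "swap c (Sub t u) = Sub (swap (Suc c) t) (swap c u)"

text \<open>rename_some c t t': t' is obtained from t by inserting a new binder y just outside x
  (x = index c, y = index c+1 in t') and renaming some (any subset) of the free
  occurrences of x into y.\<close>
inductive rename_some :: "nat \<Rightarrow> jt \<Rightarrow> jt \<Rightarrow> bool" where
  rs_keep: "rename_some c (Var c) (Var c)"
| rs_ren: "rename_some c (Var c) (Var (Suc c))"
| rs_lt: "i < c \<Longrightarrow> rename_some c (Var i) (Var i)"
| rs_gt: "i > c \<Longrightarrow> rename_some c (Var i) (Var (Suc i))"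
| rs_lam: "rename_some (Suc c) t t' \<Longrightarrow> rename_some c (Lam t) (Lam t')"
| rs_app: "rename_some c t t' \<Longrightarrow> rename_some c u u' \<Longrightarrow> rename_some c (App t u) (App t' u')"
| rs_sub: "rename_some (Suc c) t t' \<Longrightarrow> rename_some c u u' \<Longrightarrow> rename_some c (Sub t u) (Sub t' u')"

fun wrap :: "jt \<Rightarrow> jt list \<Rightarrow> jt" where
  "wrap t [] = t"
| "wrap t (u # us) = wrap (Sub t u) us"

datatype ctx = Hole | CAppL ctx jt | CAppR jt ctx | CSubL ctx jt | CSubR jt ctx | CLam ctx

fun plug :: "ctx \<Rightarrow> jt \<Rightarrow> jt" where
  "plug Hole s = s"
| "plug (CAppL C v) s = App (plug C s) v"
| "plug (CAppR v C) s = App v (plug C s)"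
| "plug (CSubL C v) s = Sub (plug C s) v"
| "plug (CSubR v C) s = Sub v (plug C s)"
| "plug (CLam C) s = Lam (plug C s)"

fun depth :: "ctx \<Rightarrow> nat" where
  "depth Hole = 0"
| "depth (CAppL C v) = depth C"
| "depth (CAppR v C) = depth C"
| "depth (CSubL C v) = Suc (depth C)"
| "depth (CSubR v C) = depth C"
| "depth (CLam C) = Suc (depth C)"

text \<open>boxed contexts B ::= t C | t[x/C] | B t | B[x/t] | \<lambda>y.B : exactly the contexts whose
  hole lies inside an argument of an application or of a jump\<close>
fun boxed :: "ctx \<Rightarrow> bool" where
  "boxed Hole = False"
| "boxed (CAppL C v) = boxed C"
| "boxed (CAppR v C) = True"
| "boxed (CSubL C v) = boxed C"
| "boxed (CSubR v C) = True"
| "boxed (CLam C) = boxed C"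

inductive cc :: "(jt \<Rightarrow> jt \<Rightarrow> bool) \<Rightarrow> jt \<Rightarrow> jt \<Rightarrow> bool" for R where
  cc_root: "R a b \<Longrightarrow> cc R a b"
| cc_lam: "cc R a b \<Longrightarrow> cc R (Lam a) (Lam b)"
| cc_appl: "cc R a b \<Longrightarrow> cc R (App a v) (App b v)"
| cc_appr: "cc R a b \<Longrightarrow> cc R (App v a) (App v b)"
| cc_subl: "cc R a b \<Longrightarrow> cc R (Sub a v) (Sub b v)"
| cc_subr: "cc R a b \<Longrightarrow> cc R (Sub v a) (Sub v b)"

inductive root_lju :: "jt \<Rightarrow> jt \<Rightarrow> bool" where
  dB: "root_lju (App (wrap (Lam t) L) u) (wrap (Sub t (shift (length L) 0 u)) L)"
| w: "occ 0 t = 0 \<Longrightarrow> root_lju (Sub t u) (down 0 t)"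
| d: "occ 0 t = 1 \<Longrightarrow> root_lju (Sub t u) (subst t 0 u)"
| c: "occ 0 t \<ge> 2 \<Longrightarrow> rename_some 0 t t' \<Longrightarrow> occ 0 t' \<ge> 1 \<Longrightarrow> occ 1 t' \<ge> 1 \<Longrightarrow>
      root_lju (Sub t u) (Sub (Sub t' (shift 1 0 u)) u)"
| u: "boxed B \<Longrightarrow> occ 0 t = 0 \<Longrightarrow>
      root_lju (plug B (Sub t (shift (depth B) 0 u0))) (Sub (shift 1 0 (plug B (down 0 t))) u0)"

definition lju :: "jt \<Rightarrow> jt \<Rightarrow> bool" where
  "lju = cc root_lju"

inductive obox_ax :: "jt \<Rightarrow> jt \<Rightarrow> bool" where
  ax_cs: "occ 0 s = 0 \<Longrightarrow> obox_ax (Sub (Sub t s) v) (Sub (Sub (swap 0 t) (shift 1 0 v)) (down 0 s))"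
| ax_lam: "occ 0 s = 0 \<Longrightarrow> obox_ax (Lam (Sub t s)) (Sub (Lam (swap 0 t)) (down 0 s))"
| ax_appl: "obox_ax (App (Sub t s) v) (Sub (App t (shift 1 0 v)) s)"
| ax_appr: "occ 0 t = 0 \<Longrightarrow> occ 0 v > 0 \<Longrightarrow> obox_ax (Sub (App t v) u) (App (down 0 t) (Sub v u))"
| ax_box: "occ 1 t = 0 \<Longrightarrow> occ 0 v > 0 \<Longrightarrow> obox_ax (Sub (Sub t v) u) (Sub (down 1 t) (Sub v u))"

inductive eqc :: "(jt \<Rightarrow> jt \<Rightarrow> bool) \<Rightarrow> jt \<Rightarrow> jt \<Rightarrow> bool" for R where
  eqc_base: "R a b \<Longrightarrow> eqc R a b"
| eqc_refl: "eqc R a a"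
| eqc_sym: "eqc R a b \<Longrightarrow> eqc R b a"
| eqc_trans: "eqc R a b \<Longrightarrow> eqc R b c \<Longrightarrow> eqc R a c"

definition obox_eq :: "jt \<Rightarrow> jt \<Rightarrow> bool" where
  "obox_eq = eqc (cc obox_ax)"

definition lju_mod_obox :: "jt \<Rightarrow> jt \<Rightarrow> bool" where
  "lju_mod_obox t u \<longleftrightarrow> (\<exists>t' u'. obox_eq t t' \<and> lju t' u' \<and> obox_eq u' u)"

inductive root_beta :: "jt \<Rightarrow> jt \<Rightarrow> bool" where
  "root_beta (App (Lam t) u) (subst t 0 u)"

definition beta :: "jt \<Rightarrow> jt \<Rightarrow> bool" where
  "beta = cc root_beta"

fun is_lambda_term :: "jt \<Rightarrow> bool" where
  "is_lambda_term (Var i) = True"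
| "is_lambda_term (Lam t) = is_lambda_term t"
| "is_lambda_term (App t u) = (is_lambda_term t \<and> is_lambda_term u)"
| "is_lambda_term (Sub t u) = False"

definition SN :: "(jt \<Rightarrow> jt \<Rightarrow> bool) \<Rightarrow> jt \<Rightarrow> bool" where
  "SN R t \<longleftrightarrow> t \<in> Wellfounded.acc {(b, a). R a b}"

end

theory Submission
  imports Defs "HOL-Library.Multiset" "HOL-Library.Function_Algebras"
begin

text \<open>
  Type \<open>\<lambda>j\<close>-terms with non-idempotent intersection types that admit weakening, in which every
  argument of an application or a jump is typed at least once. Counting the applications in a
  derivation bounds the \<open>dB\<close>-steps: such a step removes one from every copy of its redex, while
  all other rules preserve typability without increasing the count, and \<open>\<equiv>\<^sub>o\<^sub>b\<^sub>o\<^sub>x\<close> preserves it in both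
  directions. Between two \<open>dB\<close>-steps, the rules \<open>w\<close>, \<open>d\<close>, \<open>c\<close> and \<open>u\<close> strictly decrease a numeric
  measure on terms that is invariant under \<open>\<equiv>\<^sub>o\<^sub>b\<^sub>o\<^sub>x\<close>. Finally, strongly normalizing
  \<open>\<lambda>\<close>-terms are typable, since typability is reflected by head \<open>\<beta>\<close>-expansion with a typable argument.
\<close>

subsection \<open>Renamings\<close>

text \<open>The obstacle is erasure: \<open>w\<close> and erasing beta-steps discard an argument
  that may itself diverge. A type system that leaves erased arguments untyped would not see
  reductions inside them; requiring \<open>M \<noteq> {#}\<close> makes every such reduction visible
  in the count. Types are multisets so that contraction and substitution distribute the derivations
  of an argument among its uses instead of copying them. The condition that x occurs in v in the
  last two laws of the equivalence serves both invariants. In the measure, weights multiply only if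
  \<open>max 1\<close> does not intervene; in typing, every copy of v must get at least one
  derivation of u. In \<open>jm\<close>, the constant 4 is the square of the factor 2 by which
  \<open>mul\<close> weighs a box. The maximum with 1 lets a jump without occurrences still count as
  one copy, so \<open>w\<close> decreases the measure and jumps inside erased arguments stay
  visible.\<close>

definition lift :: "(nat \<Rightarrow> nat) \<Rightarrow> nat \<Rightarrow> nat" where
  "lift r = case_nat 0 (\<lambda>i. Suc (r i))"

lemma lift_simps [simp]: "lift r 0 = 0" "lift r (Suc i) = Suc (r i)"
  by (simp_all add: lift_def)

text \<open>\<open>shift\<close>, \<open>swap\<close> and the identification of two variables that
  undoes \<open>c\<close> are all renamings, so the measure and most of the typing are treated once,
  for \<open>ren\<close>.\<close>

fun ren :: "(nat \<Rightarrow> nat) \<Rightarrow> jt \<Rightarrow> jt" where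
  "ren r (Var i) = Var (r i)"
| "ren r (Lam t) = Lam (ren (lift r) t)"
| "ren r (App t u) = App (ren r t) (ren r u)"
| "ren r (Sub t u) = Sub (ren (lift r) t) (ren r u)"

lemma lift_eq_0 [simp]: "lift r i = 0 \<longleftrightarrow> i = 0"
  and lift_eq_Suc: "lift r i = Suc x \<longleftrightarrow> (\<exists>j. i = Suc j \<and> r j = x)"
  by (cases i; simp)+

lemma lift_comp: "lift (r \<circ> s) = lift r \<circ> lift s"
  by (auto simp: lift_def fun_eq_iff split: nat.split)

lemma ren_comp: "ren r (ren s t) = ren (r \<circ> s) t"
  by (induction t arbitrary: r s) (auto simp: lift_comp)

lemma inj_lift:
  assumes "inj r"
  shows "inj (lift r)"
proof (rule injI)
  fix i j
  assume "lift r i = lift r j"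
  with assms show "i = j" by (cases i; cases j) (auto dest: injD)
qed

abbreviation shiftr :: "nat \<Rightarrow> nat \<Rightarrow> nat \<Rightarrow> nat" where
  "shiftr n c \<equiv> (\<lambda>i. if i < c then i else i + n)"

definition swapr :: "nat \<Rightarrow> nat \<Rightarrow> nat" where
  "swapr c i = (if i = c then Suc c else if i = Suc c then c else i)"

lemma lift_shiftr: "lift (shiftr n c) = shiftr n (Suc c)"
  by (auto simp: lift_def fun_eq_iff split: nat.split)

lemma lift_swapr: "lift (swapr c) = swapr (Suc c)"
  by (auto simp: lift_def swapr_def fun_eq_iff split: nat.split)

lemma shift_ren: "shift n c t = ren (shiftr n c) t"
  by (induction t arbitrary: c) (simp_all add: lift_shiftr)

lemma swap_ren: "swap c t = ren (swapr c) t"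
  by (induction t arbitrary: c) (simp_all add: lift_swapr, simp add: swapr_def)

lemma inj_shiftr: "inj (shiftr n c)"
  by (auto simp: inj_def)

lemma inj_swapr: "inj (swapr c)"
  by (auto simp: inj_def swapr_def split: if_splits)

lemma shift_0 [simp]: "shift 0 c t = t"
  by (induction t arbitrary: c) auto

lemma shift_Suc: "shift 1 0 (shift k 0 t) = shift (Suc k) 0 t"
  by (simp add: shift_ren ren_comp comp_def)

lemma shift_Suc_right: "shift (Suc k) 0 t = shift k 0 (shift 1 0 t)"
  by (simp add: shift_ren ren_comp comp_def)

lemma down_shift [simp]: "down c (shift 1 c t) = t"
  by (induction t arbitrary: c) auto

text \<open>Trades the side condition that an index is absent for a syntactic shape; after that
  \<open>down\<close> disappears from the rules and laws.\<close>

lemma occ_0_shift: "occ c t = 0 \<Longrightarrow> t = shift 1 c (down c t)"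
proof (induction t arbitrary: c)
  case (Var i)
  then show ?case by (cases "i < c") (auto split: if_splits)
qed auto

lemma occ_0_shiftE:
  assumes "occ c t = 0"
  obtains s where "t = shift 1 c s" "down c t = s"
  using occ_0_shift[OF assms] by blast

text \<open>\<open>rename_some\<close> has many results, but read backwards it is a function: the
  renaming that identifies \<open>c\<close> and \<open>Suc c\<close>.\<close>

definition merge :: "nat \<Rightarrow> nat \<Rightarrow> nat" where
  "merge c i = (if i \<le> c then i else i - 1)"

lemma lift_merge: "lift (merge c) = merge (Suc c)"
  by (auto simp: lift_def merge_def fun_eq_iff split: nat.split)

lemma rename_some_merge: "rename_some c t t' \<Longrightarrow> t = ren (merge c) t'"
  by (induction rule: rename_some.induct) (simp_all add: lift_merge, simp_all add: merge_def)

subsection \<open>Jump measure\<close>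

text \<open>
  \<open>mul x t\<close> counts the occurrences of \<open>x\<close> after unfolding all jumps, each one weighted by \<open>2\<close> for
  every surrounding box; \<open>jm\<close> adds the squares of these numbers over all jumps and all their copies.
  Rule \<open>c\<close> decreases \<open>jm\<close> because \<open>a\<^sup>2 + b\<^sup>2 < (a + b)\<^sup>2\<close>, rule \<open>u\<close> because of the weight of the box.
  Multiplying by \<open>2\<close> once per box is what makes \<open>t[y/v][x/u]\<close> and \<open>t[y/v[x/u]]\<close> equally heavy.
\<close>

fun mul :: "nat \<Rightarrow> jt \<Rightarrow> nat" where
  "mul x (Var i) = (if i = x then 1 else 0)"
| "mul x (Lam t) = mul (Suc x) t"
| "mul x (App t u) = mul x t + 2 * mul x u"
| "mul x (Sub t u) = mul (Suc x) t + 2 * max 1 (mul 0 t) * mul x u"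

fun jm :: "jt \<Rightarrow> nat" where
  "jm (Var i) = 0"
| "jm (Lam t) = jm t"
| "jm (App t u) = jm t + 4 * jm u"
| "jm (Sub t u) = jm t + (max 1 (mul 0 t))\<^sup>2 * (1 + 4 * jm u)"

lemma mul_0_iff: "mul x t = 0 \<longleftrightarrow> occ x t = 0"
  by (induction t arbitrary: x) auto

text \<open>A renaming adds up the multiplicities of the preimages of \<open>x\<close>. This lemma
  and the two after it treat one, no and two preimages; elsewhere \<open>r\<close> may identify
  variables.\<close>

lemma mul_ren: "(\<And>i. r i = x \<longleftrightarrow> i = y) \<Longrightarrow> mul x (ren r t) = mul y t"
proof (induction t arbitrary: r x y)
  case (Lam t)
  show ?case using Lam.prems by (auto intro!: Lam.IH simp: lift_eq_Suc)
next
  case (Sub t u)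
  have "mul (Suc x) (ren (lift r) t) = mul (Suc y) t" "mul 0 (ren (lift r) t) = mul 0 t"
    using Sub.prems by (auto intro!: Sub.IH(1) simp: lift_eq_Suc)
  then show ?case using Sub.IH(2)[OF Sub.prems] by simp
next
  case (App t u)
  show ?case using App.IH(1)[OF App.prems] App.IH(2)[OF App.prems] by simp
qed simp_all

lemma mul_ren_0: "(\<And>i. r i \<noteq> x) \<Longrightarrow> mul x (ren r t) = 0"
proof (induction t arbitrary: r x)
  case (Lam t)
  show ?case using Lam.prems by (auto intro!: Lam.IH simp: lift_eq_Suc)
next
  case (Sub t u)
  have "mul (Suc x) (ren (lift r) t) = 0"
    using Sub.prems by (auto intro!: Sub.IH(1) simp: lift_eq_Suc)
  then show ?case using Sub.IH(2)[OF Sub.prems] by simp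
next
  case (App t u)
  show ?case using App.IH(1)[OF App.prems] App.IH(2)[OF App.prems] by simp
qed simp_all

lemma mul_ren_2:
  "(\<And>i. r i = x \<longleftrightarrow> i = y \<or> i = z) \<Longrightarrow> y \<noteq> z \<Longrightarrow> mul x (ren r t) = mul y t + mul z t"
proof (induction t arbitrary: r x y z)
  case (Lam t)
  show ?case using Lam.prems by (auto intro!: Lam.IH simp: lift_eq_Suc)
next
  case (Sub t u)
  have "mul (Suc x) (ren (lift r) t) = mul (Suc y) t + mul (Suc z) t"
    using Sub.prems by (intro Sub.IH(1)) (auto simp: lift_eq_Suc)
  moreover have "mul 0 (ren (lift r) t) = mul 0 t"
    by (rule mul_ren) simp
  ultimately show ?case using Sub.IH(2)[OF Sub.prems] by (simp add: algebra_simps)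
next
  case (App t u)
  show ?case using App.IH(1)[OF App.prems] App.IH(2)[OF App.prems] by simp
qed simp_all

text \<open>True even if \<open>r\<close> identifies variables: \<open>jm\<close> looks only at
  multiplicities of bound indices, and \<open>lift r\<close> keeps the bound index apart from all
  others.\<close>

lemma jm_ren: "jm (ren r t) = jm t"
proof (induction t arbitrary: r)
  case (Sub t u)
  have "mul 0 (ren (lift r) t) = mul 0 t"
    by (rule mul_ren) simp
  then show ?case using Sub by simp
qed auto

lemma jm_shift [simp]: "jm (shift n c t) = jm t"
  and jm_swap [simp]: "jm (swap c t) = jm t"
  by (simp_all add: shift_ren swap_ren jm_ren)

lemma mul_shift_lt [simp]: "x < c \<Longrightarrow> mul x (shift n c t) = mul x t"
  unfolding shift_ren by (rule mul_ren) auto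

lemma mul_shift_gap [simp]: "c \<le> x \<Longrightarrow> x < c + n \<Longrightarrow> mul x (shift n c t) = 0"
  unfolding shift_ren by (rule mul_ren_0) auto

lemma mul_shift_ge [simp]: "c \<le> x \<Longrightarrow> mul (x + n) (shift n c t) = mul x t"
  unfolding shift_ren by (rule mul_ren) auto

lemma mul_shift_Suc [simp]: "c \<le> x \<Longrightarrow> mul (Suc x) (shift (Suc 0) c t) = mul x t"
  using mul_shift_ge[of c x 1 t] by simp

lemma mul_swap [simp]:
  "mul 0 (swap 0 t) = mul (Suc 0) t" "mul (Suc 0) (swap 0 t) = mul 0 t"
  "mul (Suc (Suc x)) (swap 0 t) = mul (Suc (Suc x)) t"
  unfolding swap_ren by (rule mul_ren; auto simp: swapr_def)+

text \<open>Each occurrence of \<open>c\<close> becomes a copy of \<open>u\<close> under the same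
  boxes, so multiplicities multiply. The inserted copies contain no index bound inside
  \<open>t\<close>, hence the factors of the jumps of \<open>t\<close> do not change.\<close>

lemma mul_subst:
  "mul x (subst t c u)
    = mul (if x < c then x else Suc x) t + mul c t * mul x (shift c 0 u)"
proof (induction t arbitrary: x c)
  case (Lam t)
  have "mul (Suc x) (shift (Suc c) 0 u) = mul x (shift c 0 u)"
    unfolding shift_Suc[symmetric] by simp
  then show ?case using Lam[of "Suc x" "Suc c"] by auto
next
  case (Sub t s)
  have "mul (Suc x) (shift (Suc c) 0 u) = mul x (shift c 0 u)"
    unfolding shift_Suc[symmetric] by simp
  then show ?case using Sub.IH(1)[of 0 "Suc c"] Sub.IH(1)[of "Suc x" "Suc c"] Sub.IH(2)[of x c]
    by (auto simp: algebra_simps)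
qed (auto simp: algebra_simps)

text \<open>A single occurrence carries the whole multiplicity \<open>mul c t\<close>, so all
  multiplicities inside \<open>u\<close> are scaled by it and their squares by its square. With
  several occurrences the squares would be added separately.\<close>

lemma jm_subst: "occ c t \<le> 1 \<Longrightarrow> jm (subst t c u) = jm t + (mul c t)\<^sup>2 * jm u"
proof (induction t arbitrary: c)
  case (App t s)
  \<comment> \<open>At most one component holds the occurrence, so the mixed term of the squared sum
    vanishes.\<close>
  then have "occ c t = 0 \<or> occ c s = 0" "occ c t \<le> 1" "occ c s \<le> 1" by auto
  then have "mul c t = 0 \<or> mul c s = 0" by (simp add: mul_0_iff)
  then show ?case using App.IH(1)[OF \<open>occ c t \<le> 1\<close>] App.IH(2)[OF \<open>occ c s \<le> 1\<close>]
    by (auto simp: algebra_simps power2_eq_square)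
next
  case (Sub t s)
  then have "occ (Suc c) t = 0 \<or> occ c s = 0" "occ (Suc c) t \<le> 1" "occ c s \<le> 1" by auto
  then have "mul (Suc c) t = 0 \<or> mul c s = 0" by (simp add: mul_0_iff)
  moreover have "mul 0 (subst t (Suc c) u) = mul 0 t"
    by (simp add: mul_subst)
  ultimately show ?case using Sub.IH(1)[OF \<open>occ (Suc c) t \<le> 1\<close>] Sub.IH(2)[OF \<open>occ c s \<le> 1\<close>]
    by (auto simp: algebra_simps power2_eq_square power_mult_distrib)
qed auto

text \<open>The multiplicity that \<open>mul\<close> would assign to a fresh variable standing in
  the hole.\<close>

fun weight :: "ctx \<Rightarrow> nat" where
  "weight Hole = 1"
| "weight (CAppL C v) = weight C"
| "weight (CAppR v C) = 2 * weight C"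
| "weight (CSubL C v) = weight C"
| "weight (CSubR v C) = 2 * max 1 (mul 0 v) * weight C"
| "weight (CLam C) = weight C"

lemma weight_pos: "1 \<le> weight C"
  by (induction C) (auto simp: max_def)

lemma weight_boxed: "boxed C \<Longrightarrow> 2 \<le> weight C"
proof (induction C)
  case (CSubR v C)
  have "2 * 1 \<le> (2 * max 1 (mul 0 v)) * weight C"
    by (intro mult_le_mono weight_pos) auto
  then show ?case by simp
qed (use weight_pos in \<open>auto simp: max_def\<close>)

text \<open>The jump has no occurrence in its body, so \<open>max 1\<close> counts one copy of
  \<open>u\<close>; the factor 2 is the box of the jump itself.\<close>

lemma mul_plug:
  "mul x (plug C (Sub (shift 1 0 t) (shift (depth C) 0 u)))
    = mul x (plug C t) + 2 * weight C * mul x u"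
proof (induction C arbitrary: x u)
  case (CSubL C v)
  then show ?case by (simp add: shift_Suc_right[of "depth C"])
next
  case (CLam C)
  then show ?case by (simp add: shift_Suc_right[of "depth C"])
qed (auto simp: algebra_simps)

text \<open>\<open>u\<close> avoids the binders of the context, so the multiplicities bound there
  stay the same. New are only the summands of the jump and of \<open>u\<close>, scaled by the
  squared weight of the hole.\<close>

lemma jm_plug:
  "jm (plug C (Sub (shift 1 0 t) (shift (depth C) 0 u)))
    = jm (plug C t) + (weight C)\<^sup>2 * (1 + 4 * jm u)"
proof (induction C arbitrary: u)
  case (CSubL C v)
  then show ?case by (simp add: shift_Suc_right[of "depth C"] mul_plug[simplified])
next
  case (CLam C)
  then show ?case by (simp add: shift_Suc_right[of "depth C"])
qed (auto simp: algebra_simps power_mult_distrib)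

text \<open>\<open>dB\<close> is split off because typing bounds it, whereas \<open>jm\<close>
  bounds the other rules. Absence of variables is built into the shapes with \<open>shift\<close>,
  and \<open>c\<close> is read backwards through \<open>merge\<close>.\<close>

inductive root_jump :: "jt \<Rightarrow> jt \<Rightarrow> bool" where
  w: "root_jump (Sub (shift 1 0 t) u) t"
| d: "occ 0 t = 1 \<Longrightarrow> root_jump (Sub t u) (subst t 0 u)"
| c: "occ 0 t \<ge> 1 \<Longrightarrow> occ 1 t \<ge> 1 \<Longrightarrow>
      root_jump (Sub (ren (merge 0) t) u) (Sub (Sub t (shift 1 0 u)) u)"
| u: "boxed B \<Longrightarrow>
      root_jump (plug B (Sub (shift 1 0 t) (shift (depth B) 0 u)))
        (Sub (shift 1 0 (plug B t)) u)"

inductive root_dB :: "jt \<Rightarrow> jt \<Rightarrow> bool" where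
  "root_dB (App (wrap (Lam t) L) u) (wrap (Sub t (shift (length L) 0 u)) L)"

lemma root_lju_cases: "root_lju a b \<Longrightarrow> root_dB a b \<or> root_jump a b"
proof (induction rule: root_lju.induct)
  case (w t u)
  then show ?case by (metis occ_0_shiftE root_jump.w)
next
  case (c t t' u)
  then show ?case using rename_some_merge root_jump.c by blast
next
  case (u B t u0)
  then show ?case by (metis occ_0_shiftE root_jump.u)
qed (auto intro: root_dB.intros root_jump.intros)

lemma cc_lju_cases: "lju a b \<Longrightarrow> cc root_dB a b \<or> cc root_jump a b"
  unfolding lju_def by (induction rule: cc.induct) (auto intro: cc.intros dest: root_lju_cases)

inductive obox_law :: "jt \<Rightarrow> jt \<Rightarrow> bool" where
  cs: "obox_law (Sub (Sub t (shift 1 0 s)) v) (Sub (Sub (swap 0 t) (shift 1 0 v)) s)"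
| lam: "obox_law (Lam (Sub t (shift 1 0 s))) (Sub (Lam (swap 0 t)) s)"
| appl: "obox_law (App (Sub t s) v) (Sub (App t (shift 1 0 v)) s)"
| appr: "occ 0 v > 0 \<Longrightarrow> obox_law (Sub (App (shift 1 0 t) v) u) (App t (Sub v u))"
| box: "occ 0 v > 0 \<Longrightarrow> obox_law (Sub (Sub (shift 1 1 t) v) u) (Sub t (Sub v u))"

lemma obox_ax_law: "obox_ax a b \<Longrightarrow> obox_law a b"
  by (induction rule: obox_ax.induct)
    (metis obox_law.intros occ_0_shiftE)+

section \<open>The measure under steps and laws\<close>

lemma root_jump_mul: "root_jump a b \<Longrightarrow> mul x b \<le> mul x a"
proof (induction rule: root_jump.induct)
  case (w t u)
  then show ?case by simp
next
  case (d t u)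
  then show ?case using mul_0_iff[of 0 t] by (simp add: mul_subst max_def)
next
  case (c t u)
  have "mul 0 t \<ge> 1" "mul 1 t \<ge> 1" using c mul_0_iff[of _ t] by (metis less_one not_le)+
  moreover have "mul 0 (ren (merge 0) t) = mul 0 t + mul 1 t"
    by (rule mul_ren_2) (auto simp: merge_def)
  moreover have "mul (Suc x) (ren (merge 0) t) = mul (Suc (Suc x)) t"
    by (rule mul_ren) (auto simp: merge_def)
  ultimately show ?case by (simp add: max_def algebra_simps)
next
  case (u B t u)
  then show ?case using weight_pos[of B] by (simp add: mul_plug[simplified])
qed

lemma root_jump_jm: "root_jump a b \<Longrightarrow> jm b < jm a"
proof (induction rule: root_jump.induct)
  case (w t u)
  then show ?case by simp
next
  case (d t u)
  then have "0 < mul 0 t" using mul_0_iff[of 0 t] by simp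
  then show ?case using d
    by (simp add: jm_subst max_def algebra_simps Suc_le_eq)
next
  case (c t u)
  have m: "mul 0 t \<ge> 1" "mul 1 t \<ge> 1" using c mul_0_iff[of _ t] by (metis less_one not_le)+
  moreover have "mul 0 (ren (merge 0) t) = mul 0 t + mul 1 t"
    by (rule mul_ren_2) (auto simp: merge_def)
  moreover have "((mul 0 t)\<^sup>2 + (mul 1 t)\<^sup>2) * (1 + 4 * jm u) < (mul 0 t + mul 1 t)\<^sup>2 * (1 + 4 * jm u)"
    using m by (intro mult_strict_right_mono) (auto simp: power2_eq_square algebra_simps)
  ultimately show ?case by (simp add: jm_ren max_def add_mult_distrib)
next
  case (u B t u)
  have "1 * (1 + 4 * jm u) < (weight B)\<^sup>2 * (1 + 4 * jm u)"
    using weight_boxed[OF u] by (intro mult_strict_right_mono one_less_power) auto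
  then show ?case by (simp add: jm_plug[simplified])
qed

text \<open>A jump around the redex scales its own summand by the multiplicity of its variable in
  the body, so \<open>jm\<close> decreases in all contexts only because no multiplicity
  grows.\<close>

lemma cc_jump_mul: "cc root_jump a b \<Longrightarrow> mul x b \<le> mul x a"
proof (induction arbitrary: x rule: cc.induct)
  case (cc_subl a b v)
  then show ?case by (auto intro!: add_mono mult_le_mono max.mono)
qed (auto simp: root_jump_mul)

lemma cc_jump_jm: "cc root_jump a b \<Longrightarrow> jm b < jm a"
proof (induction rule: cc.induct)
  case (cc_subl a b v)
  have "max 1 (mul 0 b) \<le> max 1 (mul 0 a)" using cc_jump_mul[OF cc_subl(1)] by (meson max.mono order_refl)
  then have "(max 1 (mul 0 b))\<^sup>2 * (1 + 4 * jm v) \<le> (max 1 (mul 0 a))\<^sup>2 * (1 + 4 * jm v)"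
    by (intro mult_le_mono power_mono) auto
  then show ?case using cc_subl by simp
qed (auto simp: root_jump_jm)

lemma obox_law_mul: "obox_law a b \<Longrightarrow> mul x a = mul x b"
proof (induction rule: obox_law.induct)
  case (box v t u)
  have "mul (Suc (Suc x)) (shift 1 1 t) = mul (Suc x) t" by simp
  moreover have "mul 0 v \<ge> 1" using box mul_0_iff[of 0 v] by simp
  ultimately show ?case by (simp add: max_def algebra_simps)
next
  case (appr v t u)
  moreover have "mul 0 v \<ge> 1" using appr mul_0_iff[of 0 v] by simp
  ultimately show ?case by (simp add: max_def algebra_simps)
qed (auto simp: algebra_simps)

lemma obox_law_jm: "obox_law a b \<Longrightarrow> jm a = jm b"
proof (induction rule: obox_law.induct)
  case (box v t u)
  moreover have "mul 0 v \<ge> 1" using box mul_0_iff[of 0 v] by simp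
  ultimately show ?case by (simp add: max_def algebra_simps power2_eq_square)
next
  case (appr v t u)
  moreover have "mul 0 v \<ge> 1" using appr mul_0_iff[of 0 v] by simp
  ultimately show ?case by (simp add: max_def algebra_simps power2_eq_square)
qed (auto simp: algebra_simps)

lemma cc_obox_mul: "cc obox_ax a b \<Longrightarrow> mul x a = mul x b"
  by (induction arbitrary: x rule: cc.induct) (auto dest: obox_ax_law obox_law_mul)

lemma cc_obox_jm: "cc obox_ax a b \<Longrightarrow> jm a = jm b"
  by (induction rule: cc.induct) (auto dest: obox_ax_law obox_law_jm simp: cc_obox_mul)

lemma obox_eq_jm: "obox_eq a b \<Longrightarrow> jm a = jm b"
  unfolding obox_eq_def by (induction rule: eqc.induct) (auto dest: cc_obox_jm)

subsection \<open>Affine intersection types\<close>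

datatype ty = Base | Arr "ty multiset" ty

text \<open>
  Induction leaves eta-expanded environments behind, which these rules would tear apart.
\<close>

declare plus_fun_apply [simp del] zero_fun_apply [simp del]

type_synonym env = "nat \<Rightarrow> ty multiset"

text \<open>
  \<open>many P M\<close> gives one derivation for each type in \<open>M\<close> and adds up their environments. The last
  argument of \<open>typed\<close> is an upper bound on the number of application nodes. Weakening happens at
  variables; since \<open>M \<noteq> {#}\<close> is required for arguments, erased ones are typed as well.
\<close>

inductive many :: "(env \<Rightarrow> ty \<Rightarrow> nat \<Rightarrow> bool) \<Rightarrow> ty multiset \<Rightarrow> env \<Rightarrow> nat \<Rightarrow> bool" for P where
  many_empty: "many P {#} \<Gamma> n"
| many_add: "P \<Gamma> \<sigma> n \<Longrightarrow> many P M \<Delta> m \<Longrightarrow> many P (add_mset \<sigma> M) (\<Gamma> + \<Delta>) (n + m)"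

definition econs :: "ty multiset \<Rightarrow> env \<Rightarrow> env" where
  "econs M \<Gamma> = case_nat M \<Gamma>"

text \<open>Recursion on the term lets \<open>typed u\<close> be handed to \<open>many\<close> as a
  finished predicate, so that \<open>many\<close> stays an ordinary inductive definition.\<close>

primrec typed :: "jt \<Rightarrow> env \<Rightarrow> ty \<Rightarrow> nat \<Rightarrow> bool" where
  "typed (Var i) = (\<lambda>\<Gamma> \<tau> n. \<tau> \<in># \<Gamma> i)"
| "typed (Lam t) = (\<lambda>\<Gamma> \<tau> n. \<exists>M \<sigma>. \<tau> = Arr M \<sigma> \<and> typed t (econs M \<Gamma>) \<sigma> n)"
| "typed (App t u) = (\<lambda>\<Gamma> \<tau> n. \<exists>\<Gamma>1 \<Gamma>2 n1 n2 M. \<Gamma> = \<Gamma>1 + \<Gamma>2 \<and> n = Suc (n1 + n2) \<and> M \<noteq> {#} \<and>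
     typed t \<Gamma>1 (Arr M \<tau>) n1 \<and> many (typed u) M \<Gamma>2 n2)"
| "typed (Sub t u) = (\<lambda>\<Gamma> \<tau> n. \<exists>\<Gamma>1 \<Gamma>2 n1 n2 M. \<Gamma> = \<Gamma>1 + \<Gamma>2 \<and> n = n1 + n2 \<and> M \<noteq> {#} \<and>
     typed t (econs M \<Gamma>1) \<tau> n1 \<and> many (typed u) M \<Gamma>2 n2)"

lemma typed_LamI: "typed t (econs M \<Gamma>) \<sigma> n \<Longrightarrow> typed (Lam t) \<Gamma> (Arr M \<sigma>) n"
  by auto

lemma typed_AppI:
  "typed t \<Gamma> (Arr M \<tau>) n \<Longrightarrow> many (typed u) M \<Delta> m \<Longrightarrow> M \<noteq> {#} \<Longrightarrow>
    typed (App t u) (\<Gamma> + \<Delta>) \<tau> (Suc (n + m))"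
  unfolding typed.simps by blast

lemma typed_SubI:
  "typed t (econs M \<Gamma>) \<tau> n \<Longrightarrow> many (typed u) M \<Delta> m \<Longrightarrow> M \<noteq> {#} \<Longrightarrow>
    typed (Sub t u) (\<Gamma> + \<Delta>) \<tau> (n + m)"
  unfolding typed.simps by blast

lemma typed_LamE:
  assumes "typed (Lam t) \<Gamma> \<tau> n"
  obtains M \<sigma> where "\<tau> = Arr M \<sigma>" "typed t (econs M \<Gamma>) \<sigma> n"
  using assms by auto

lemma typed_AppE:
  assumes "typed (App t u) \<Gamma> \<tau> n"
  obtains \<Gamma>1 \<Gamma>2 n1 n2 M where "\<Gamma> = \<Gamma>1 + \<Gamma>2" "n = Suc (n1 + n2)" "M \<noteq> {#}"
    "typed t \<Gamma>1 (Arr M \<tau>) n1" "many (typed u) M \<Gamma>2 n2"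
  using assms by auto

lemma typed_SubE:
  assumes "typed (Sub t u) \<Gamma> \<tau> n"
  obtains \<Gamma>1 \<Gamma>2 n1 n2 M where "\<Gamma> = \<Gamma>1 + \<Gamma>2" "n = n1 + n2" "M \<noteq> {#}"
    "typed t (econs M \<Gamma>1) \<tau> n1" "many (typed u) M \<Gamma>2 n2"
  using assms by auto

lemma econs_simps [simp]: "econs M \<Gamma> 0 = M" "econs M \<Gamma> (Suc i) = \<Gamma> i"
  by (simp_all add: econs_def)

lemma env_eq_iff: "\<Gamma> = \<Delta> \<longleftrightarrow> \<Gamma> 0 = \<Delta> 0 \<and> (\<forall>i. \<Gamma> (Suc i) = \<Delta> (Suc i))" for \<Gamma> \<Delta> :: env
  by (metis ext not0_implies_Suc)

lemma econs_eta: "econs (\<Gamma> 0) (\<lambda>i. \<Gamma> (Suc i)) = \<Gamma>"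
  by (simp add: env_eq_iff)

lemma econs_inject [simp]: "econs M \<Gamma> = econs N \<Delta> \<longleftrightarrow> M = N \<and> \<Gamma> = \<Delta>"
  by (metis econs_simps ext)

lemma econs_add [simp]: "econs M \<Gamma> + econs N \<Delta> = econs (M + N) (\<Gamma> + \<Delta>)"
  by (simp add: env_eq_iff plus_fun_apply)

lemma econs_cases: obtains M \<Delta> where "\<Gamma> = econs M \<Delta>"
  by (metis econs_eta)

lemma econs_eq_addE:
  assumes "econs M \<Gamma> = A + B"
  obtains M1 M2 \<Gamma>1 \<Gamma>2 where "A = econs M1 \<Gamma>1" "B = econs M2 \<Gamma>2" "M = M1 + M2" "\<Gamma> = \<Gamma>1 + \<Gamma>2"
  by (metis assms econs_add econs_cases econs_inject)

section \<open>Families of derivations\<close>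

lemma many_map:
  assumes "many P M \<Gamma> n" "\<And>\<Gamma> \<sigma> n. P \<Gamma> \<sigma> n \<Longrightarrow> Q (f \<Gamma>) \<sigma> n" "\<And>\<Gamma> \<Delta>. f (\<Gamma> + \<Delta>) = f \<Gamma> + f \<Delta>"
  shows "many Q M (f \<Gamma>) n"
  using assms(1) by induction (auto intro: many.intros simp: assms(2,3))

lemma many_mono:
  assumes "many P M \<Gamma> n" "\<And>\<Gamma> \<sigma> n. P \<Gamma> \<sigma> n \<Longrightarrow> Q \<Gamma> \<sigma> n"
  shows "many Q M \<Gamma> n"
  using many_map[of P M \<Gamma> n Q "\<lambda>x. x"] assms by auto

text \<open>Environments and counts add up over a family, so one member can take the whole surplus;
  an empty family absorbs it because \<open>many_empty\<close> accepts any environment and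
  count.\<close>

lemma many_weaken_if:
  assumes "\<And>\<Gamma> \<sigma> n \<Delta> k. P \<Gamma> \<sigma> n \<Longrightarrow> P (\<Gamma> + \<Delta>) \<sigma> (n + k)"
    and "many P M \<Gamma> n"
  shows "many P M (\<Gamma> + \<Delta>) (n + k)"
  using assms(2)
proof cases
  case (many_add \<Gamma>1 \<sigma> n1 M' \<Delta>1 m1)
  have "many P (add_mset \<sigma> M') ((\<Gamma>1 + \<Delta>) + \<Delta>1) ((n1 + k) + m1)"
    using many_add assms(1) by (intro many.intros)
  then show ?thesis using many_add by (simp add: ac_simps)
qed (auto intro: many.intros)

lemma typed_weaken: "typed t \<Gamma> \<tau> n \<Longrightarrow> typed t (\<Gamma> + \<Delta>) \<tau> (n + k)"
proof (induction t arbitrary: \<Gamma> \<tau> n \<Delta> k)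
  case (Lam t)
  from Lam.prems show ?case
  proof (rule typed_LamE)
    fix M \<sigma> assume "\<tau> = Arr M \<sigma>" "typed t (econs M \<Gamma>) \<sigma> n"
    with Lam.IH[of "econs M \<Gamma>" \<sigma> n "econs {#} \<Delta>" k] show ?case by auto
  qed
next
  case (App t u)
  from App.prems show ?case
  proof (rule typed_AppE)
    fix \<Gamma>1 \<Gamma>2 n1 n2 M
    assume *: "\<Gamma> = \<Gamma>1 + \<Gamma>2" "n = Suc (n1 + n2)" "M \<noteq> {#}"
     "typed t \<Gamma>1 (Arr M \<tau>) n1" "many (typed u) M \<Gamma>2 n2"
    from typed_AppI[OF App.IH(1)[OF *(4)] *(5,3), of \<Delta> k] show ?case
      by (simp only: * ac_simps add_Suc add_Suc_right)
  qed
next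
  case (Sub t u)
  from Sub.prems show ?case
  proof (rule typed_SubE)
    fix \<Gamma>1 \<Gamma>2 n1 n2 M
    assume *: "\<Gamma> = \<Gamma>1 + \<Gamma>2" "n = n1 + n2" "M \<noteq> {#}"
     "typed t (econs M \<Gamma>1) \<tau> n1" "many (typed u) M \<Gamma>2 n2"
    from Sub.IH(1)[OF *(4), of "econs {#} \<Delta>" k] have "typed t (econs M (\<Gamma>1 + \<Delta>)) \<tau> (n1 + k)"
      by simp
    from typed_SubI[OF this *(5,3)] show ?case
      by (simp only: * ac_simps)
  qed
qed (simp add: plus_fun_apply)

lemma many_weaken: "many (typed t) M \<Gamma> n \<Longrightarrow> many (typed t) M (\<Gamma> + \<Delta>) (n + k)"
  by (rule many_weaken_if[where P = "typed t"]) (rule typed_weaken)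

text \<open>Inversion at an arbitrary element, not just the one added last: the sums are
  commutative, so derivations can be exchanged.\<close>

lemma many_addE:
  assumes "many P (add_mset \<sigma> M) \<Gamma> n"
  obtains \<Gamma>1 \<Gamma>2 n1 n2 where "\<Gamma> = \<Gamma>1 + \<Gamma>2" "n = n1 + n2" "P \<Gamma>1 \<sigma> n1" "many P M \<Gamma>2 n2"
proof -
  have "\<exists>\<Gamma>1 \<Gamma>2 n1 n2. \<Gamma> = \<Gamma>1 + \<Gamma>2 \<and> n = n1 + n2 \<and> P \<Gamma>1 \<sigma> n1 \<and> many P M \<Gamma>2 n2"
    if "many P N \<Gamma> n" "N = add_mset \<sigma> M" for N
    using that
  proof (induction arbitrary: M)
    case (many_add \<Gamma> \<rho> n N \<Delta> m)
    show ?case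
    proof (cases "\<rho> = \<sigma>")
      case True
      then show ?thesis using many_add by auto
    next
      case False
      then obtain M' where M': "N = add_mset \<sigma> M'" "M = add_mset \<rho> M'"
        using many_add.prems by (auto simp: add_eq_conv_ex)
      from many_add.IH[OF this(1)] obtain \<Gamma>1 \<Gamma>2 n1 n2
        where *: "\<Delta> = \<Gamma>1 + \<Gamma>2" "m = n1 + n2" "P \<Gamma>1 \<sigma> n1" "many P M' \<Gamma>2 n2" by auto
      have "many P M (\<Gamma> + \<Gamma>2) (n + n2)" using M' * many_add.hyps by (auto intro: many.intros)
      with * show ?thesis
        by (intro exI[of _ \<Gamma>1] exI[of _ "\<Gamma> + \<Gamma>2"] exI[of _ n1] exI[of _ "n + n2"]) (simp add: ac_simps)
    qed
  qed simp
  then show ?thesis using assms that by blast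
qed

text \<open>Non-idempotence at work: a family is distributed between two uses, and nothing is
  counted twice.\<close>

lemma many_splitE:
  assumes "many P (M + N) \<Gamma> n"
  obtains \<Gamma>1 \<Gamma>2 n1 n2 where "\<Gamma> = \<Gamma>1 + \<Gamma>2" "n = n1 + n2" "many P M \<Gamma>1 n1" "many P N \<Gamma>2 n2"
proof -
  have "\<exists>\<Gamma>1 \<Gamma>2 n1 n2. \<Gamma> = \<Gamma>1 + \<Gamma>2 \<and> n = n1 + n2 \<and> many P M \<Gamma>1 n1 \<and> many P N \<Gamma>2 n2"
    using assms
  proof (induction M arbitrary: \<Gamma> n)
    case empty
    then show ?case
      by (intro exI[of _ 0] exI[of _ \<Gamma>] exI[of _ n]) (simp add: many.intros)
  next
    case (add \<sigma> M)
    then have "many P (add_mset \<sigma> (M + N)) \<Gamma> n" by simp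
    then obtain \<Gamma>1 \<Gamma>2 n1 n2 where *: "\<Gamma> = \<Gamma>1 + \<Gamma>2" "n = n1 + n2" "P \<Gamma>1 \<sigma> n1" "many P (M + N) \<Gamma>2 n2"
      by (rule many_addE)
    from add.IH[OF *(4)] obtain \<Gamma>3 \<Gamma>4 n3 n4
      where "\<Gamma>2 = \<Gamma>3 + \<Gamma>4" "n2 = n3 + n4" "many P M \<Gamma>3 n3" "many P N \<Gamma>4 n4" by auto
    with * show ?case
      by (intro exI[of _ "\<Gamma>1 + \<Gamma>3"] exI[of _ \<Gamma>4] exI[of _ "n1 + n3"] exI[of _ n4])
        (simp add: ac_simps many.intros)
  qed
  then show ?thesis using that by blast
qed

lemma many_union:
  assumes "many (typed t) M \<Gamma> n" "many (typed t) N \<Delta> m"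
  shows "many (typed t) (M + N) (\<Gamma> + \<Delta>) (n + m)"
  using assms
proof induction
  case (many_empty \<Gamma> n)
  then show ?case using many_weaken[of t N \<Delta> m \<Gamma> n] by (simp add: ac_simps)
next
  case (many_add \<Gamma> \<sigma> n M \<Delta>' m')
  from many.many_add[of "typed t", OF many_add.hyps(1) many_add.IH[OF many_add.prems]]
  show ?case by (simp add: ac_simps)
qed

text \<open>Weakening gives the direction from left to right: the empty rest of the family may carry
  an environment and a count of its own.\<close>

lemma many_single: "many P {#\<sigma>#} \<Gamma> n \<longleftrightarrow> P \<Gamma> \<sigma> n" if "\<And>\<Gamma> \<sigma> n \<Delta> k. P \<Gamma> \<sigma> n \<Longrightarrow> P (\<Gamma> + \<Delta>) \<sigma> (n + k)"
proof
  show "P \<Gamma> \<sigma> n" if "many P {#\<sigma>#} \<Gamma> n"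
    using that by (rule many_addE) (auto intro: \<open>\<And>\<Gamma> \<sigma> n \<Delta> k. P \<Gamma> \<sigma> n \<Longrightarrow> P (\<Gamma> + \<Delta>) \<sigma> (n + k)\<close>)
  show "many P {#\<sigma>#} \<Gamma> n" if "P \<Gamma> \<sigma> n"
    using many_add[OF that many_empty[of P 0 0]] by simp
qed

section \<open>Typing under renaming\<close>

definition push :: "(nat \<Rightarrow> nat) \<Rightarrow> env \<Rightarrow> env" where
  "push r \<Gamma> j = (if j \<in> range r then \<Gamma> (inv r j) else {#})"

lemma push_add: "push r (\<Gamma> + \<Delta>) = push r \<Gamma> + push r \<Delta>"
  by (auto simp: push_def fun_eq_iff plus_fun_apply)

lemma econs_lift: "econs M \<Gamma> \<circ> lift r = econs M (\<Gamma> \<circ> r)"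
  by (simp add: env_eq_iff)

lemma push_lift:
  assumes "inj r"
  shows "push (lift r) (econs M \<Gamma>) = econs M (push r \<Gamma>)"
proof -
  have "inv (lift r) 0 = 0"
    by (metis assms inj_lift inv_f_f lift_simps(1))
  moreover have "inv (lift r) (Suc (r i)) = Suc (inv r (r i))" for i
    by (metis assms inj_lift inv_f_f lift_simps(2))
  moreover have "0 \<in> range (lift r)" by (metis lift_simps(1) rangeI)
  moreover have "Suc i \<in> range (lift r) \<longleftrightarrow> i \<in> range r" for i
    by (metis (full_types) lift_eq_Suc rangeE rangeI)
  ultimately have "push (lift r) (econs M \<Gamma>) j = econs M (push r \<Gamma>) j" for j
    by (cases j) (auto simp: push_def)
  then show ?thesis ..
qed

lemma typed_ren_push: "inj r \<Longrightarrow> typed t \<Gamma> \<tau> n \<Longrightarrow> typed (ren r t) (push r \<Gamma>) \<tau> n"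
proof (induction t arbitrary: r \<Gamma> \<tau> n)
  case (Var i)
  then show ?case by (simp add: push_def)
next
  case (Lam t)
  from Lam.prems(2) show ?case
    by (rule typed_LamE)
      (use Lam.IH[OF inj_lift[OF Lam.prems(1)]] push_lift[OF Lam.prems(1)] in \<open>force\<close>)
next
  case (App t u)
  have "many (typed (ren r u)) M (push r \<Gamma>) n" if "many (typed u) M \<Gamma> n" for M \<Gamma> n
    by (rule many_map[where f = "push r" and P = "typed u"]) (rule that App.IH(2)[OF App.prems(1)] push_add | assumption)+
  with App.prems(2) show ?case
    by (elim typed_AppE) (auto simp only: push_add ren.simps intro!: typed_AppI App.IH(1)[OF App.prems(1)])
next
  case (Sub t u)
  have "many (typed (ren r u)) M (push r \<Gamma>) n" if "many (typed u) M \<Gamma> n" for M \<Gamma> n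
    by (rule many_map[where f = "push r" and P = "typed u"]) (rule that Sub.IH(2)[OF Sub.prems(1)] push_add | assumption)+
  moreover have "typed (ren (lift r) t) (econs M (push r \<Gamma>)) \<tau> n" if "typed t (econs M \<Gamma>) \<tau> n" for M \<Gamma> n
    using Sub.IH(1)[OF inj_lift[OF Sub.prems(1)] that] by (simp only: push_lift[OF Sub.prems(1)])
  ultimately show ?case using Sub.prems(2)
    by (elim typed_SubE) (auto simp only: push_add ren.simps intro!: typed_SubI)
qed

lemma comp_add: "(\<Gamma> + \<Delta>) \<circ> r = (\<Gamma> \<circ> r) + (\<Delta> \<circ> r)" for \<Gamma> \<Delta> :: env
  by (simp add: fun_eq_iff plus_fun_apply)

lemma typed_ren_comp: "typed (ren r t) \<Gamma> \<tau> n \<Longrightarrow> typed t (\<Gamma> \<circ> r) \<tau> n"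
proof (induction t arbitrary: r \<Gamma> \<tau> n)
  case (Lam t)
  from Lam.prems have "typed (Lam (ren (lift r) t)) \<Gamma> \<tau> n" by simp
  then show ?case
    by (elim typed_LamE) (metis Lam.IH econs_lift typed_LamI)
next
  case (App t u)
  have "many (typed u) M (\<Gamma> \<circ> r) n" if "many (typed (ren r u)) M \<Gamma> n" for M \<Gamma> n
    by (rule many_map[where f = "\<lambda>\<Gamma>. \<Gamma> \<circ> r" and P = "typed (ren r u)"]) (rule that App.IH(2) comp_add | assumption)+
  moreover from App.prems have "typed (App (ren r t) (ren r u)) \<Gamma> \<tau> n" by simp
  ultimately show ?case
    by (elim typed_AppE) (auto simp only: comp_add intro!: typed_AppI App.IH(1))
next
  case (Sub t u)
  have "many (typed u) M (\<Gamma> \<circ> r) n" if "many (typed (ren r u)) M \<Gamma> n" for M \<Gamma> n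
    by (rule many_map[where f = "\<lambda>\<Gamma>. \<Gamma> \<circ> r" and P = "typed (ren r u)"]) (rule that Sub.IH(2) comp_add | assumption)+
  moreover have "typed t (econs M (\<Gamma> \<circ> r)) \<tau> n" if "typed (ren (lift r) t) (econs M \<Gamma>) \<tau> n" for M \<Gamma> n
    using Sub.IH(1)[OF that] by (simp only: econs_lift)
  moreover from Sub.prems have "typed (Sub (ren (lift r) t) (ren r u)) \<Gamma> \<tau> n" by simp
  ultimately show ?case
    by (elim typed_SubE) (auto simp only: comp_add intro!: typed_SubI)
qed simp

lemma typed_ren:
  assumes "inj r"
  shows "typed (ren r t) \<Gamma> \<tau> n \<longleftrightarrow> typed t (\<Gamma> \<circ> r) \<tau> n"
proof
  assume "typed t (\<Gamma> \<circ> r) \<tau> n"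
  then have "typed (ren r t) (push r (\<Gamma> \<circ> r)) \<tau> n" by (rule typed_ren_push[OF assms])
  \<comment> \<open>\<open>push r\<close> leaves the indices outside the range of \<open>r\<close>
    empty; weakening puts the entries of \<open>\<Gamma>\<close> back.\<close>
  from typed_weaken[OF this, of "\<lambda>j. if j \<in> range r then {#} else \<Gamma> j" 0]
  have "typed (ren r t) (push r (\<Gamma> \<circ> r) + (\<lambda>j. if j \<in> range r then {#} else \<Gamma> j)) \<tau> n" by simp
  also have "push r (\<Gamma> \<circ> r) + (\<lambda>j. if j \<in> range r then {#} else \<Gamma> j) = \<Gamma>"
    using assms by (auto simp: fun_eq_iff push_def plus_fun_apply)
  finally show "typed (ren r t) \<Gamma> \<tau> n" .
qed (rule typed_ren_comp)

lemma many_ren: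
  assumes "inj r"
  shows "many (typed (ren r t)) M \<Gamma> n \<longleftrightarrow> many (typed t) M (\<Gamma> \<circ> r) n"
proof
  assume "many (typed t) M (\<Gamma> \<circ> r) n"
  then show "many (typed (ren r t)) M \<Gamma> n"
  proof (induction M arbitrary: \<Gamma> n)
    case (add \<sigma> M)
    from add.prems obtain \<Gamma>1 \<Gamma>2 n1 n2 where *: "\<Gamma> \<circ> r = \<Gamma>1 + \<Gamma>2" "n = n1 + n2" "typed t \<Gamma>1 \<sigma> n1"
      "many (typed t) M \<Gamma>2 n2" by (rule many_addE)
    \<comment> \<open>The split is known only along \<open>r\<close>, so one summand has to take
      over the entries of \<open>\<Gamma>\<close> outside the range.\<close>
    define \<Delta> where "\<Delta> j = (if j \<in> range r then \<Gamma>2 (inv r j) else \<Gamma> j)" for j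
    have "\<Delta> \<circ> r = \<Gamma>2" using assms by (auto simp: fun_eq_iff \<Delta>_def)
    moreover have "\<Gamma> = push r \<Gamma>1 + \<Delta>"
    proof (rule ext)
      fix j
      show "\<Gamma> j = (push r \<Gamma>1 + \<Delta>) j"
      proof (cases "j \<in> range r")
        case True
        then obtain i where "j = r i" by auto
        then show ?thesis using assms fun_cong[OF *(1), of i] by (simp add: \<Delta>_def push_def plus_fun_apply)
      qed (simp add: \<Delta>_def push_def plus_fun_apply)
    qed
    ultimately show ?case using * add.IH[of \<Delta> n2] typed_ren_push[OF assms *(3)]
      by (auto intro: many.intros)
  qed (rule many_empty)
next
  assume "many (typed (ren r t)) M \<Gamma> n"
  then show "many (typed t) M (\<Gamma> \<circ> r) n"
    by (rule many_map[where f = "\<lambda>\<Gamma>. \<Gamma> \<circ> r" and P = "typed (ren r t)"])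
      (rule typed_ren_comp comp_add | assumption)+
qed

lemma typed_shift: "typed (shift 1 0 t) (econs M \<Gamma>) \<tau> n \<longleftrightarrow> typed t \<Gamma> \<tau> n"
  and many_shift: "many (typed (shift 1 0 t)) N (econs M \<Gamma>) n \<longleftrightarrow> many (typed t) N \<Gamma> n"
  and typed_shift1: "typed (shift 1 1 t) (econs N (econs M \<Gamma>)) \<tau> n \<longleftrightarrow> typed t (econs N \<Gamma>) \<tau> n"
  and typed_swap: "typed (swap 0 t) (econs N (econs M \<Gamma>)) \<tau> n \<longleftrightarrow> typed t (econs M (econs N \<Gamma>)) \<tau> n"
proof -
  have 1: "econs M \<Gamma> \<circ> shiftr 1 0 = \<Gamma>" by (simp add: fun_eq_iff)
  have 2: "econs N (econs M \<Gamma>) \<circ> shiftr 1 1 = econs N \<Gamma>" by (simp add: env_eq_iff)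
  have "(econs N (econs M \<Gamma>) \<circ> swapr 0) i = econs M (econs N \<Gamma>) i" for i
    by (cases i; cases "i - 1") (auto simp: swapr_def)
  then have 3: "econs N (econs M \<Gamma>) \<circ> swapr 0 = econs M (econs N \<Gamma>)" ..
  show "typed (shift 1 0 t) (econs M \<Gamma>) \<tau> n \<longleftrightarrow> typed t \<Gamma> \<tau> n"
    "many (typed (shift 1 0 t)) N (econs M \<Gamma>) n \<longleftrightarrow> many (typed t) N \<Gamma> n"
    "typed (shift 1 1 t) (econs N (econs M \<Gamma>)) \<tau> n \<longleftrightarrow> typed t (econs N \<Gamma>) \<tau> n"
    "typed (swap 0 t) (econs N (econs M \<Gamma>)) \<tau> n \<longleftrightarrow> typed t (econs M (econs N \<Gamma>)) \<tau> n"
    by (simp_all only: shift_ren swap_ren typed_ren many_ren inj_shiftr inj_swapr 1 2 3)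
qed

subsection \<open>Subject reduction\<close>

text \<open>As the count in \<open>typed\<close> is only an upper bound, not increasing it can be
  stated with the same \<open>n\<close>.\<close>

definition type_le :: "jt \<Rightarrow> jt \<Rightarrow> bool" where
  "type_le a b \<longleftrightarrow> (\<forall>\<Gamma> \<tau> n. typed a \<Gamma> \<tau> n \<longrightarrow> typed b \<Gamma> \<tau> n)"

definition type_less :: "jt \<Rightarrow> jt \<Rightarrow> bool" where
  "type_less a b \<longleftrightarrow> (\<forall>\<Gamma> \<tau> n. typed a \<Gamma> \<tau> n \<longrightarrow> (\<exists>m<n. typed b \<Gamma> \<tau> m))"

lemma type_leI: "(\<And>\<Gamma> \<tau> n. typed a \<Gamma> \<tau> n \<Longrightarrow> typed b \<Gamma> \<tau> n) \<Longrightarrow> type_le a b"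
  by (simp add: type_le_def)

lemma type_leD: "type_le a b \<Longrightarrow> typed a \<Gamma> \<tau> n \<Longrightarrow> typed b \<Gamma> \<tau> n"
  by (simp add: type_le_def)

lemma type_le_many: "type_le a b \<Longrightarrow> many (typed a) M \<Gamma> n \<Longrightarrow> many (typed b) M \<Gamma> n"
  by (rule many_mono[where P = "typed a"]) (auto dest: type_leD)

lemma type_le_refl: "type_le a a"
  by (simp add: type_le_def)

lemma type_le_trans: "type_le a b \<Longrightarrow> type_le b c \<Longrightarrow> type_le a c"
  by (simp add: type_le_def)

lemma type_le_Lam: "type_le a b \<Longrightarrow> type_le (Lam a) (Lam b)"
  and type_le_AppL: "type_le a b \<Longrightarrow> type_le (App a v) (App b v)"
  and type_le_AppR: "type_le a b \<Longrightarrow> type_le (App v a) (App v b)"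
  and type_le_SubL: "type_le a b \<Longrightarrow> type_le (Sub a v) (Sub b v)"
  and type_le_SubR: "type_le a b \<Longrightarrow> type_le (Sub v a) (Sub v b)"
  by (auto intro!: type_leI elim!: typed_LamE typed_AppE typed_SubE intro: typed_AppI typed_SubI dest: type_leD type_le_many
    simp del: typed.simps intro: typed_LamI)

lemma cc_type_le: "cc R a b \<Longrightarrow> (\<And>a b. R a b \<Longrightarrow> type_le a b) \<Longrightarrow> type_le a b"
  by (induction rule: cc.induct) (auto intro: type_le_Lam type_le_AppL type_le_AppR type_le_SubL type_le_SubR)

lemma typed_mono: "typed t \<Gamma> \<tau> n \<Longrightarrow> n \<le> m \<Longrightarrow> typed t \<Gamma> \<tau> m"
  using typed_weaken[of t \<Gamma> \<tau> n 0 "m - n"] by simp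

lemma type_less_type_le: "type_less a b \<Longrightarrow> type_le a b"
  by (meson less_imp_le type_leI type_less_def typed_mono)

text \<open>An empty family satisfies every bound, even 0, so a step inside an argument lowers the
  count only if the argument is typed at least once.\<close>

lemma type_less_many:
  assumes "type_less a b" "many (typed a) M \<Gamma> n" "M \<noteq> {#}"
  shows "\<exists>m<n. many (typed b) M \<Gamma> m"
proof -
  obtain \<sigma> N where M: "M = add_mset \<sigma> N" using assms(3) by (meson multiset_cases)
  from assms(2)[unfolded M] show ?thesis
  proof (rule many_addE)
    fix \<Gamma>1 \<Gamma>2 n1 n2
    assume *: "\<Gamma> = \<Gamma>1 + \<Gamma>2" "n = n1 + n2" "typed a \<Gamma>1 \<sigma> n1" "many (typed a) N \<Gamma>2 n2"
    from assms(1) *(3) obtain m where m: "m < n1" "typed b \<Gamma>1 \<sigma> m" unfolding type_less_def by blast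
    from many_add[of "typed b", OF m(2) type_le_many[OF type_less_type_le[OF assms(1)] *(4)]] m(1)
    show ?thesis unfolding M * by (meson add_less_mono1)
  qed
qed

lemma type_less_Lam: "type_less (Lam a) (Lam b)"
  and type_less_AppL: "type_less (App a v) (App b v)"
  and type_less_AppR: "type_less (App v a) (App v b)"
  and type_less_SubL: "type_less (Sub a v) (Sub b v)"
  and type_less_SubR: "type_less (Sub v a) (Sub v b)" if ab: "type_less a b"
proof -
  have 1: "\<exists>m<n. typed b \<Gamma> \<tau> m" if "typed a \<Gamma> \<tau> n" for \<Gamma> \<tau> n
    using ab that by (auto simp: type_less_def)
  note 2 = type_less_many[OF ab]
  show "type_less (Lam a) (Lam b)" unfolding type_less_def by (metis 1 typed_LamE typed_LamI)
  show "type_less (App a v) (App b v)" unfolding type_less_def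
    by (clarify, elim typed_AppE) (metis 1 typed_AppI add_less_mono1 Suc_less_eq)
  show "type_less (App v a) (App v b)" unfolding type_less_def
    by (clarify, elim typed_AppE) (metis 2 typed_AppI add_less_cancel_left Suc_less_eq)
  show "type_less (Sub a v) (Sub b v)" unfolding type_less_def
    by (clarify, elim typed_SubE) (metis 1 typed_SubI add_less_mono1)
  show "type_less (Sub v a) (Sub v b)" unfolding type_less_def
    by (clarify, elim typed_SubE) (metis 2 typed_SubI add_less_cancel_left)
qed

lemma cc_type_less: "cc R a b \<Longrightarrow> (\<And>a b. R a b \<Longrightarrow> type_less a b) \<Longrightarrow> type_less a b"
  by (induction rule: cc.induct) (auto intro: type_less_Lam type_less_AppL type_less_AppR type_less_SubL type_less_SubR)

text \<open>Holds because every argument is typed: an occurrence inside an argument is met by at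
  least one derivation.\<close>

lemma typed_occ: "typed t \<Gamma> \<tau> n \<Longrightarrow> 0 < occ i t \<Longrightarrow> \<Gamma> i \<noteq> {#}"
proof (induction t arbitrary: \<Gamma> \<tau> n i)
  case (Lam t)
  from Lam.prems(1) show ?case
    by (rule typed_LamE) (use Lam.IH[of _ _ _ "Suc i"] Lam.prems(2) in force)
next
  case (App t u)
  have 2: "M = {#} \<or> \<Gamma> i \<noteq> {#}" if "many (typed u) M \<Gamma> n" "0 < occ i u" for M \<Gamma> n
    using that(1) by induction (auto simp: plus_fun_apply dest: App.IH(2)[OF _ that(2)])
  from App.prems(1) show ?case
    by (rule typed_AppE) (use App.IH(1)[of _ _ _ i] 2 App.prems(2) in \<open>fastforce simp: plus_fun_apply\<close>)
next
  case (Sub t u)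
  have 2: "M = {#} \<or> \<Gamma> i \<noteq> {#}" if "many (typed u) M \<Gamma> n" "0 < occ i u" for M \<Gamma> n
    using that(1) by induction (auto simp: plus_fun_apply dest: Sub.IH(2)[OF _ that(2)])
  from Sub.prems(1) show ?case
    by (rule typed_SubE) (use Sub.IH(1)[of _ _ _ "Suc i"] 2 Sub.prems(2) in \<open>fastforce simp: plus_fun_apply\<close>)
qed (auto split: if_splits)

text \<open>Each copy of the jump brings its own family for \<open>u\<close>. Pooling them gives one
  family for all copies of \<open>v\<close>, as if the jump stood outside the box.\<close>

lemma many_SubE:
  assumes "many (typed (Sub v u)) N \<Gamma> n"
  obtains \<Gamma>1 \<Gamma>2 M n1 n2 where "\<Gamma> = \<Gamma>1 + \<Gamma>2" "n = n1 + n2" "N \<noteq> {#} \<longrightarrow> M \<noteq> {#}"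
    "many (typed v) N (econs M \<Gamma>1) n1" "many (typed u) M \<Gamma>2 n2"
proof -
  have "\<exists>\<Gamma>1 \<Gamma>2 M n1 n2. \<Gamma> = \<Gamma>1 + \<Gamma>2 \<and> n = n1 + n2 \<and> (N \<noteq> {#} \<longrightarrow> M \<noteq> {#}) \<and>
    many (typed v) N (econs M \<Gamma>1) n1 \<and> many (typed u) M \<Gamma>2 n2"
    using assms
  proof induction
    case (many_empty \<Gamma> n)
    then show ?case
      by (intro exI[of _ 0] exI[of _ \<Gamma>] exI[of _ "{#}"] exI[of _ n]) (simp add: many.intros)
  next
    case (many_add \<Gamma> \<sigma> n N \<Delta> m)
    from many_add.IH obtain \<Gamma>1 \<Gamma>2 M n1 n2 where *: "\<Delta> = \<Gamma>1 + \<Gamma>2" "m = n1 + n2"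
      "many (typed v) N (econs M \<Gamma>1) n1" "many (typed u) M \<Gamma>2 n2" by blast
    from many_add.hyps(1) obtain \<Gamma>3 \<Gamma>4 n3 n4 K where **: "\<Gamma> = \<Gamma>3 + \<Gamma>4" "n = n3 + n4" "K \<noteq> {#}"
      "typed v (econs K \<Gamma>3) \<sigma> n3" "many (typed u) K \<Gamma>4 n4" by (rule typed_SubE)
    from many.many_add[of "typed v", OF **(4) *(3)]
    have "many (typed v) (add_mset \<sigma> N) (econs (K + M) (\<Gamma>3 + \<Gamma>1)) (n3 + n1)" by simp
    moreover have "many (typed u) (K + M) (\<Gamma>4 + \<Gamma>2) (n4 + n2)" by (rule many_union[OF **(5) *(4)])
    moreover have "\<Gamma> + \<Delta> = (\<Gamma>3 + \<Gamma>1) + (\<Gamma>4 + \<Gamma>2)" "n + m = (n3 + n1) + (n4 + n2)"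
      unfolding * ** by (simp_all add: ac_simps)
    moreover have "K + M \<noteq> {#}" using **(3) by simp
    ultimately show ?case by blast
  qed
  then show ?thesis using that by blast
qed

lemma many_SubI:
  assumes "0 < occ 0 v"
  shows "many (typed v) N (econs M \<Gamma>) n \<Longrightarrow> many (typed u) M \<Delta> m \<Longrightarrow>
    many (typed (Sub v u)) N (\<Gamma> + \<Delta>) (n + m)"
proof (induction N arbitrary: M \<Gamma> n \<Delta> m)
  case (add \<sigma> N)
  from add.prems(1) show ?case
  proof (rule many_addE)
    fix \<Gamma>1 \<Gamma>2 n1 n2
    assume *: "econs M \<Gamma> = \<Gamma>1 + \<Gamma>2" "n = n1 + n2" "typed v \<Gamma>1 \<sigma> n1" "many (typed v) N \<Gamma>2 n2"
    from *(1) show ?thesis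
    proof (rule econs_eq_addE)
      fix M1 M2 \<Gamma>1' \<Gamma>2'
      assume **: "\<Gamma>1 = econs M1 \<Gamma>1'" "\<Gamma>2 = econs M2 \<Gamma>2'" "M = M1 + M2" "\<Gamma> = \<Gamma>1' + \<Gamma>2'"
      from add.prems(2)[unfolded **(3)] obtain \<Delta>1 \<Delta>2 m1 m2 where
        ***: "\<Delta> = \<Delta>1 + \<Delta>2" "m = m1 + m2" "many (typed u) M1 \<Delta>1 m1" "many (typed u) M2 \<Delta>2 m2"
        by (rule many_splitE)
      \<comment> \<open>Each copy of the jump needs a nonempty share of the pooled family, and gets
        one since the variable occurs in \<open>v\<close>.\<close>
      have "M1 \<noteq> {#}" using typed_occ[OF *(3) assms] ** by simp
      then have "typed (Sub v u) (\<Gamma>1' + \<Delta>1) \<sigma> (n1 + m1)" using * ** *** by (intro typed_SubI) auto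
      moreover have "many (typed (Sub v u)) N (\<Gamma>2' + \<Delta>2) (n2 + m2)"
        using * ** *** by (intro add.IH[of M2]) auto
      ultimately have "many (typed (Sub v u)) (add_mset \<sigma> N)
        ((\<Gamma>1' + \<Delta>1) + (\<Gamma>2' + \<Delta>2)) ((n1 + m1) + (n2 + m2))" by (rule many_add)
      then show ?thesis unfolding * ** *** by (simp add: ac_simps)
    qed
  qed
qed (rule many_empty)

section \<open>Typing under the equivalence and rule \<open>u\<close>\<close>

lemma swap_swap: "swap c (swap c t) = t"
  by (induction t arbitrary: c) auto

lemma swap_shift: "swap 0 (shift 1 0 t) = shift 1 1 t"
proof -
  have "swapr 0 \<circ> shiftr 1 0 = shiftr 1 1" by (auto simp: swapr_def fun_eq_iff)
  then show ?thesis by (simp only: swap_ren shift_ren ren_comp)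
qed

lemma type_le_cs: "type_le (Sub (Sub t (shift 1 0 s)) v) (Sub (Sub (swap 0 t) (shift 1 0 v)) s)"
proof (rule type_leI)
  fix \<Gamma> \<tau> n
  assume "typed (Sub (Sub t (shift 1 0 s)) v) \<Gamma> \<tau> n"
  then obtain \<Gamma>1 \<Gamma>2 n1 n2 M where *: "\<Gamma> = \<Gamma>1 + \<Gamma>2" "n = n1 + n2" "M \<noteq> {#}"
    "typed (Sub t (shift 1 0 s)) (econs M \<Gamma>1) \<tau> n1" "many (typed v) M \<Gamma>2 n2"
    by (rule typed_SubE)
  from *(4) obtain \<Delta>1 \<Delta>2 m1 m2 N where **: "econs M \<Gamma>1 = \<Delta>1 + \<Delta>2" "n1 = m1 + m2" "N \<noteq> {#}"
    "typed t (econs N \<Delta>1) \<tau> m1" "many (typed (shift 1 0 s)) N \<Delta>2 m2"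
    by (rule typed_SubE)
  from **(1) obtain M1 M2 \<Delta>3 \<Delta>4 where ***: "\<Delta>1 = econs M1 \<Delta>3" "\<Delta>2 = econs M2 \<Delta>4" "M = M1 + M2" "\<Gamma>1 = \<Delta>3 + \<Delta>4"
    by (rule econs_eq_addE)
  \<comment> \<open>\<open>M2\<close> is the part of \<open>M\<close> that went to the shifted
    \<open>s\<close>, where its variable is absent. Weakening hands it to \<open>t\<close>, so that
    \<open>v\<close> can keep its family for all of \<open>M\<close>.\<close>
  have "typed t (econs N (econs M \<Delta>3)) \<tau> m1"
    using typed_weaken[OF **(4), of "econs {#} (econs M2 0)" 0] *** by simp
  then have 1: "typed (swap 0 t) (econs M (econs N \<Delta>3)) \<tau> m1" by (simp add: typed_swap)
  have 2: "many (typed (shift 1 0 v)) M (econs {#} \<Gamma>2) n2"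
    using *(5) by (simp only: many_shift)
  have "typed (Sub (swap 0 t) (shift 1 0 v)) (econs N (\<Delta>3 + \<Gamma>2)) \<tau> (m1 + n2)"
    using typed_SubI[OF 1 2 *(3)] by simp
  moreover have "many (typed s) N \<Delta>4 m2" using **(5) *** by (simp only: many_shift)
  ultimately have "typed (Sub (Sub (swap 0 t) (shift 1 0 v)) s) ((\<Delta>3 + \<Gamma>2) + \<Delta>4) \<tau> ((m1 + n2) + m2)"
    using **(3) by (rule typed_SubI)
  then show "typed (Sub (Sub (swap 0 t) (shift 1 0 v)) s) \<Gamma> \<tau> n"
    by (simp add: * ** *** ac_simps)
qed

lemma type_le_lam: "type_le (Lam (Sub t (shift 1 0 s))) (Sub (Lam (swap 0 t)) s)"
proof (rule type_leI)
  fix \<Gamma> \<tau> n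
  assume "typed (Lam (Sub t (shift 1 0 s))) \<Gamma> \<tau> n"
  then obtain M \<sigma> where *: "\<tau> = Arr M \<sigma>" "typed (Sub t (shift 1 0 s)) (econs M \<Gamma>) \<sigma> n"
    by (rule typed_LamE)
  from *(2) obtain \<Delta>1 \<Delta>2 m1 m2 N where **: "econs M \<Gamma> = \<Delta>1 + \<Delta>2" "n = m1 + m2" "N \<noteq> {#}"
    "typed t (econs N \<Delta>1) \<sigma> m1" "many (typed (shift 1 0 s)) N \<Delta>2 m2"
    by (rule typed_SubE)
  from **(1) obtain M1 M2 \<Delta>3 \<Delta>4 where ***: "\<Delta>1 = econs M1 \<Delta>3" "\<Delta>2 = econs M2 \<Delta>4" "M = M1 + M2" "\<Gamma> = \<Delta>3 + \<Delta>4"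
    by (rule econs_eq_addE)
  have "typed t (econs N (econs M \<Delta>3)) \<sigma> m1"
    using typed_weaken[OF **(4), of "econs {#} (econs M2 0)" 0] *** by simp
  then have "typed (Lam (swap 0 t)) (econs N \<Delta>3) \<tau> m1" unfolding * by (intro typed_LamI) (simp add: typed_swap)
  moreover have "many (typed s) N \<Delta>4 m2" using **(5) *** by (simp only: many_shift)
  ultimately show "typed (Sub (Lam (swap 0 t)) s) \<Gamma> \<tau> n"
    unfolding **(2) ***(4) using **(3) by (rule typed_SubI)
qed

lemma type_le_lam_rev: "type_le (Sub (Lam (swap 0 t)) s) (Lam (Sub t (shift 1 0 s)))"
proof (rule type_leI)
  fix \<Gamma> \<tau> n
  assume "typed (Sub (Lam (swap 0 t)) s) \<Gamma> \<tau> n"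
  then obtain \<Gamma>1 \<Gamma>2 n1 n2 M where *: "\<Gamma> = \<Gamma>1 + \<Gamma>2" "n = n1 + n2" "M \<noteq> {#}"
    "typed (Lam (swap 0 t)) (econs M \<Gamma>1) \<tau> n1" "many (typed s) M \<Gamma>2 n2"
    by (rule typed_SubE)
  from *(4) obtain N \<sigma> where **: "\<tau> = Arr N \<sigma>" "typed (swap 0 t) (econs N (econs M \<Gamma>1)) \<sigma> n1"
    by (rule typed_LamE)
  have 1: "typed t (econs M (econs N \<Gamma>1)) \<sigma> n1" using **(2) by (simp add: typed_swap)
  have 2: "many (typed (shift 1 0 s)) M (econs {#} \<Gamma>2) n2" using *(5) by (simp only: many_shift)
  have "typed (Sub t (shift 1 0 s)) (econs N (\<Gamma>1 + \<Gamma>2)) \<sigma> (n1 + n2)"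
    using typed_SubI[OF 1 2 *(3)] by simp
  then show "typed (Lam (Sub t (shift 1 0 s))) \<Gamma> \<tau> n" unfolding * ** by (rule typed_LamI)
qed

lemma type_le_appl: "type_le (App (Sub t s) v) (Sub (App t (shift 1 0 v)) s)"
proof (rule type_leI)
  fix \<Gamma> \<tau> n
  assume "typed (App (Sub t s) v) \<Gamma> \<tau> n"
  then obtain \<Gamma>1 \<Gamma>2 n1 n2 M where *: "\<Gamma> = \<Gamma>1 + \<Gamma>2" "n = Suc (n1 + n2)" "M \<noteq> {#}"
    "typed (Sub t s) \<Gamma>1 (Arr M \<tau>) n1" "many (typed v) M \<Gamma>2 n2"
    by (rule typed_AppE)
  from *(4) obtain \<Delta>1 \<Delta>2 m1 m2 N where **: "\<Gamma>1 = \<Delta>1 + \<Delta>2" "n1 = m1 + m2" "N \<noteq> {#}"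
    "typed t (econs N \<Delta>1) (Arr M \<tau>) m1" "many (typed s) N \<Delta>2 m2"
    by (rule typed_SubE)
  have 2: "many (typed (shift 1 0 v)) M (econs {#} \<Gamma>2) n2" using *(5) by (simp only: many_shift)
  have "typed (App t (shift 1 0 v)) (econs N (\<Delta>1 + \<Gamma>2)) \<tau> (Suc (m1 + n2))"
    using typed_AppI[OF **(4) 2 *(3)] by simp
  from typed_SubI[OF this **(5,3)]
  show "typed (Sub (App t (shift 1 0 v)) s) \<Gamma> \<tau> n" by (simp add: * ** ac_simps)
qed

lemma type_le_appl_rev: "type_le (Sub (App t (shift 1 0 v)) s) (App (Sub t s) v)"
proof (rule type_leI)
  fix \<Gamma> \<tau> n
  assume "typed (Sub (App t (shift 1 0 v)) s) \<Gamma> \<tau> n"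
  then obtain \<Gamma>1 \<Gamma>2 n1 n2 M where *: "\<Gamma> = \<Gamma>1 + \<Gamma>2" "n = n1 + n2" "M \<noteq> {#}"
    "typed (App t (shift 1 0 v)) (econs M \<Gamma>1) \<tau> n1" "many (typed s) M \<Gamma>2 n2"
    by (rule typed_SubE)
  from *(4) obtain \<Delta>1 \<Delta>2 m1 m2 N where **: "econs M \<Gamma>1 = \<Delta>1 + \<Delta>2" "n1 = Suc (m1 + m2)" "N \<noteq> {#}"
    "typed t \<Delta>1 (Arr N \<tau>) m1" "many (typed (shift 1 0 v)) N \<Delta>2 m2"
    by (rule typed_AppE)
  from **(1) obtain M1 M2 \<Delta>3 \<Delta>4 where ***: "\<Delta>1 = econs M1 \<Delta>3" "\<Delta>2 = econs M2 \<Delta>4" "M = M1 + M2" "\<Gamma>1 = \<Delta>3 + \<Delta>4"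
    by (rule econs_eq_addE)
  have "typed t (econs M \<Delta>3) (Arr N \<tau>) m1"
    using typed_weaken[OF **(4), of "econs M2 0" 0] *** by simp
  from typed_SubI[OF this *(5,3)] have 1: "typed (Sub t s) (\<Delta>3 + \<Gamma>2) (Arr N \<tau>) (m1 + n2)" .
  have 2: "many (typed v) N \<Delta>4 m2" using **(5) *** by (simp only: many_shift)
  from typed_AppI[OF 1 2 **(3)] show "typed (App (Sub t s) v) \<Gamma> \<tau> n"
    by (simp add: * ** *** ac_simps)
qed

lemma type_le_appr_rev: "type_le (App t (Sub v u)) (Sub (App (shift 1 0 t) v) u)"
proof (rule type_leI)
  fix \<Gamma> \<tau> n
  assume "typed (App t (Sub v u)) \<Gamma> \<tau> n"
  then obtain \<Gamma>1 \<Gamma>2 n1 n2 M where *: "\<Gamma> = \<Gamma>1 + \<Gamma>2" "n = Suc (n1 + n2)" "M \<noteq> {#}"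
    "typed t \<Gamma>1 (Arr M \<tau>) n1" "many (typed (Sub v u)) M \<Gamma>2 n2"
    by (rule typed_AppE)
  from *(5) obtain \<Delta>1 \<Delta>2 N m1 m2 where **: "\<Gamma>2 = \<Delta>1 + \<Delta>2" "n2 = m1 + m2" "M \<noteq> {#} \<longrightarrow> N \<noteq> {#}"
    "many (typed v) M (econs N \<Delta>1) m1" "many (typed u) N \<Delta>2 m2"
    by (rule many_SubE)
  have 1: "typed (shift 1 0 t) (econs {#} \<Gamma>1) (Arr M \<tau>) n1" using *(4) by (simp only: typed_shift)
  have "typed (App (shift 1 0 t) v) (econs N (\<Gamma>1 + \<Delta>1)) \<tau> (Suc (n1 + m1))"
    using typed_AppI[OF 1 **(4) *(3)] by simp
  from typed_SubI[OF this **(5)] show "typed (Sub (App (shift 1 0 t) v) u) \<Gamma> \<tau> n"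
    using *(3) **(3) by (simp only: * ** ac_simps add_Suc add_Suc_right not_False_eq_True simp_thms)
qed

lemma type_le_appr:
  assumes "0 < occ 0 v"
  shows "type_le (Sub (App (shift 1 0 t) v) u) (App t (Sub v u))"
proof (rule type_leI)
  fix \<Gamma> \<tau> n
  assume "typed (Sub (App (shift 1 0 t) v) u) \<Gamma> \<tau> n"
  then obtain \<Gamma>1 \<Gamma>2 n1 n2 M where *: "\<Gamma> = \<Gamma>1 + \<Gamma>2" "n = n1 + n2" "M \<noteq> {#}"
    "typed (App (shift 1 0 t) v) (econs M \<Gamma>1) \<tau> n1" "many (typed u) M \<Gamma>2 n2"
    by (rule typed_SubE)
  from *(4) obtain \<Delta>1 \<Delta>2 m1 m2 N where **: "econs M \<Gamma>1 = \<Delta>1 + \<Delta>2" "n1 = Suc (m1 + m2)" "N \<noteq> {#}"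
    "typed (shift 1 0 t) \<Delta>1 (Arr N \<tau>) m1" "many (typed v) N \<Delta>2 m2"
    by (rule typed_AppE)
  from **(1) obtain M1 M2 \<Delta>3 \<Delta>4 where ***: "\<Delta>1 = econs M1 \<Delta>3" "\<Delta>2 = econs M2 \<Delta>4" "M = M1 + M2" "\<Gamma>1 = \<Delta>3 + \<Delta>4"
    by (rule econs_eq_addE)
  have 1: "typed t \<Delta>3 (Arr N \<tau>) m1" using **(4) *** by (simp only: typed_shift)
  have "many (typed v) N (econs M \<Delta>4) m2"
    using many_weaken[OF **(5), of "econs M1 0" 0] *** by (simp add: ac_simps)
  from many_SubI[OF assms this *(5)] have 2: "many (typed (Sub v u)) N (\<Delta>4 + \<Gamma>2) (m2 + n2)" .
  from typed_AppI[OF 1 2 **(3)] show "typed (App t (Sub v u)) \<Gamma> \<tau> n"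
    by (simp add: * ** *** ac_simps)
qed

lemma type_le_box_rev: "type_le (Sub t (Sub v u)) (Sub (Sub (shift 1 1 t) v) u)"
proof (rule type_leI)
  fix \<Gamma> \<tau> n
  assume "typed (Sub t (Sub v u)) \<Gamma> \<tau> n"
  then obtain \<Gamma>1 \<Gamma>2 n1 n2 M where *: "\<Gamma> = \<Gamma>1 + \<Gamma>2" "n = n1 + n2" "M \<noteq> {#}"
    "typed t (econs M \<Gamma>1) \<tau> n1" "many (typed (Sub v u)) M \<Gamma>2 n2"
    by (rule typed_SubE)
  from *(5) obtain \<Delta>1 \<Delta>2 N m1 m2 where **: "\<Gamma>2 = \<Delta>1 + \<Delta>2" "n2 = m1 + m2" "M \<noteq> {#} \<longrightarrow> N \<noteq> {#}"
    "many (typed v) M (econs N \<Delta>1) m1" "many (typed u) N \<Delta>2 m2"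
    by (rule many_SubE)
  have 1: "typed (shift 1 1 t) (econs M (econs {#} \<Gamma>1)) \<tau> n1" using *(4) by (simp only: typed_shift1)
  have "typed (Sub (shift 1 1 t) v) (econs N (\<Gamma>1 + \<Delta>1)) \<tau> (n1 + m1)"
    using typed_SubI[OF 1 **(4) *(3)] by simp
  from typed_SubI[OF this **(5)] show "typed (Sub (Sub (shift 1 1 t) v) u) \<Gamma> \<tau> n"
    using *(3) **(3) by (simp only: * ** ac_simps not_False_eq_True simp_thms)
qed

lemma type_le_box:
  assumes "0 < occ 0 v"
  shows "type_le (Sub (Sub (shift 1 1 t) v) u) (Sub t (Sub v u))"
proof (rule type_leI)
  fix \<Gamma> \<tau> n
  assume "typed (Sub (Sub (shift 1 1 t) v) u) \<Gamma> \<tau> n"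
  then obtain \<Gamma>1 \<Gamma>2 n1 n2 M where *: "\<Gamma> = \<Gamma>1 + \<Gamma>2" "n = n1 + n2" "M \<noteq> {#}"
    "typed (Sub (shift 1 1 t) v) (econs M \<Gamma>1) \<tau> n1" "many (typed u) M \<Gamma>2 n2"
    by (rule typed_SubE)
  from *(4) obtain \<Delta>1 \<Delta>2 m1 m2 N where **: "econs M \<Gamma>1 = \<Delta>1 + \<Delta>2" "n1 = m1 + m2" "N \<noteq> {#}"
    "typed (shift 1 1 t) (econs N \<Delta>1) \<tau> m1" "many (typed v) N \<Delta>2 m2"
    by (rule typed_SubE)
  from **(1) obtain M1 M2 \<Delta>3 \<Delta>4 where ***: "\<Delta>1 = econs M1 \<Delta>3" "\<Delta>2 = econs M2 \<Delta>4" "M = M1 + M2" "\<Gamma>1 = \<Delta>3 + \<Delta>4"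
    by (rule econs_eq_addE)
  have 1: "typed t (econs N \<Delta>3) \<tau> m1" using **(4) *** by (simp only: typed_shift1)
  have "many (typed v) N (econs M \<Delta>4) m2"
    using many_weaken[OF **(5), of "econs M1 0" 0] *** by (simp add: ac_simps)
  from many_SubI[OF assms this *(5)] have 2: "many (typed (Sub v u)) N (\<Delta>4 + \<Gamma>2) (m2 + n2)" .
  from typed_SubI[OF 1 2 **(3)] show "typed (Sub t (Sub v u)) \<Gamma> \<tau> n"
    by (simp add: * ** *** ac_simps)
qed

lemma obox_law_type_le: "obox_law a b \<Longrightarrow> type_le a b \<and> type_le b a"
proof (induction rule: obox_law.induct)
  case (cs t s v)
  \<comment> \<open>The law is symmetric up to the involution \<open>swap\<close>, so its converse
    is another instance.\<close>
  show ?case using type_le_cs[of t s v] type_le_cs[of "swap 0 t" v s] by (simp only: swap_swap simp_thms)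
qed (simp_all only: type_le_lam type_le_lam_rev type_le_appl type_le_appl_rev type_le_appr type_le_appr_rev type_le_box type_le_box_rev simp_thms)

lemma cc_obox_type_le: "cc obox_ax a b \<Longrightarrow> type_le a b \<and> type_le b a"
  by (induction rule: cc.induct)
    (auto dest: obox_ax_law obox_law_type_le intro: type_le_Lam type_le_AppL type_le_AppR type_le_SubL type_le_SubR)

lemma obox_eq_type_le: "obox_eq a b \<Longrightarrow> type_le a b \<and> type_le b a"
  unfolding obox_eq_def
  by (induction rule: eqc.induct) (auto dest: cc_obox_type_le intro: type_le_refl type_le_trans)

text \<open>The jump travels outwards one constructor at a time, each time by a law of the
  equivalence. It leaves boxes by \<open>type_le_appr_rev\<close> and
  \<open>type_le_box_rev\<close>, the directions in which its variable may be absent from the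
  box.\<close>

lemma type_le_plug: "type_le (plug B (Sub (shift 1 0 t) (shift (depth B) 0 u))) (Sub (shift 1 0 (plug B t)) u)"
proof (induction B arbitrary: u)
  case Hole
  then show ?case by (simp add: type_le_refl)
next
  case (CAppL C v)
  from type_le_trans[OF type_le_AppL[OF CAppL] type_le_appl] show ?case by simp
next
  case (CAppR v C)
  from type_le_trans[OF type_le_AppR[OF CAppR] type_le_appr_rev] show ?case by simp
next
  case (CSubL C v)
  from type_le_trans[OF type_le_SubL[OF CSubL] type_le_cs]
  show ?case by (simp add: shift_Suc_right[of "depth C"] swap_shift[simplified])
next
  case (CSubR v C)
  from type_le_trans[OF type_le_SubR[OF CSubR] type_le_box_rev] show ?case by simp
next
  case (CLam C)
  from type_le_trans[OF type_le_Lam[OF CLam] type_le_lam]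
  show ?case by (simp add: shift_Suc_right[of "depth C"] swap_shift[simplified])
qed

section \<open>Typing under substitution and contraction\<close>

definition ins :: "nat \<Rightarrow> ty multiset \<Rightarrow> env \<Rightarrow> env" where
  "ins c M \<Gamma> i = (if i < c then \<Gamma> i else if i = c then M else \<Gamma> (i - 1))"

lemma ins_0: "ins 0 M \<Gamma> = econs M \<Gamma>"
  by (simp add: env_eq_iff ins_def)

lemma econs_ins: "econs N (ins c M \<Gamma>) = ins (Suc c) M (econs N \<Gamma>)"
proof (rule ext)
  show "econs N (ins c M \<Gamma>) i = ins (Suc c) M (econs N \<Gamma>) i" for i
    by (cases i; cases "i - 1") (auto simp: ins_def)
qed

lemma ins_add: "ins c M \<Gamma> + ins c N \<Delta> = ins c (M + N) (\<Gamma> + \<Delta>)"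
  by (auto simp: ins_def fun_eq_iff plus_fun_apply)

lemma ins_inject: "ins c M \<Gamma> = ins c N \<Delta> \<longleftrightarrow> M = N \<and> \<Gamma> = \<Delta>"
proof (safe)
  assume *: "ins c M \<Gamma> = ins c N \<Delta>"
  from fun_cong[OF *, of c] show "M = N" by (simp add: ins_def)
  show "\<Gamma> = \<Delta>"
  proof (rule ext)
    fix i
    show "\<Gamma> i = \<Delta> i" using fun_cong[OF *, of "if i < c then i else Suc i"] by (simp add: ins_def split: if_splits)
  qed
qed

lemma ins_cases: obtains M \<Delta> where "\<Gamma> = ins c M \<Delta>"
proof
  show "\<Gamma> = ins c (\<Gamma> c) (\<lambda>i. if i < c then \<Gamma> i else \<Gamma> (Suc i))"
    by (auto simp: ins_def fun_eq_iff)
qed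

lemma ins_eq_addE:
  assumes "ins c M \<Gamma> = A + B"
  obtains M1 M2 \<Gamma>1 \<Gamma>2 where "A = ins c M1 \<Gamma>1" "B = ins c M2 \<Gamma>2" "M = M1 + M2" "\<Gamma> = \<Gamma>1 + \<Gamma>2"
  by (metis assms ins_add ins_cases ins_inject)

text \<open>The assumption is the induction hypothesis of \<open>typed_subst\<close> for an
  argument; application and jump share this passage from one derivation to a family.\<close>

lemma many_subst:
  assumes "\<And>M \<Gamma> \<tau> n \<Delta> m. typed t (ins c M \<Gamma>) \<tau> n \<Longrightarrow> many (typed u) M \<Delta> m \<Longrightarrow>
    typed t' (\<Gamma> + \<Delta>) \<tau> (n + m)"
  shows "many (typed t) N (ins c M \<Gamma>) n \<Longrightarrow> many (typed u) M \<Delta> m \<Longrightarrow>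
    many (typed t') N (\<Gamma> + \<Delta>) (n + m)"
proof (induction N arbitrary: M \<Gamma> n \<Delta> m)
  case (add \<sigma> N)
  from add.prems(1) obtain A B n1 n2 where *: "ins c M \<Gamma> = A + B" "n = n1 + n2"
    "typed t A \<sigma> n1" "many (typed t) N B n2" by (rule many_addE)
  from *(1) obtain M1 M2 \<Gamma>1 \<Gamma>2 where **: "A = ins c M1 \<Gamma>1" "B = ins c M2 \<Gamma>2" "M = M1 + M2" "\<Gamma> = \<Gamma>1 + \<Gamma>2"
    by (rule ins_eq_addE)
  from add.prems(2)[unfolded **] obtain \<Delta>1 \<Delta>2 m1 m2 where ***: "\<Delta> = \<Delta>1 + \<Delta>2" "m = m1 + m2"
    "many (typed u) M1 \<Delta>1 m1" "many (typed u) M2 \<Delta>2 m2" by (rule many_splitE)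
  from many_add[of "typed t'", OF assms[OF *(3)[unfolded **] ***(3)] add.IH[OF *(4)[unfolded **] ***(4)]]
  show ?case unfolding * ** *** by (simp add: ac_simps)
qed (rule many_empty)

lemma typed_subst:
  "typed t (ins c M \<Gamma>) \<tau> n \<Longrightarrow> many (typed (shift c 0 u)) M \<Delta> m \<Longrightarrow>
    typed (subst t c u) (\<Gamma> + \<Delta>) \<tau> (n + m)"
proof (induction t arbitrary: c M \<Gamma> \<tau> n \<Delta> m)
  case (Var i)
  show ?case
  proof (cases "i = c")
    case True
    then have "\<tau> \<in># M" using Var.prems(1) by (simp add: ins_def)
    \<comment> \<open>One derivation of the family replaces the occurrence; weakening absorbs the
      others.\<close>
    then obtain M' where "M = add_mset \<tau> M'" by (metis insert_DiffM)
    with Var.prems(2) obtain \<Delta>1 \<Delta>2 m1 m2 where *: "\<Delta> = \<Delta>1 + \<Delta>2" "m = m1 + m2"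
      "typed (shift c 0 u) \<Delta>1 \<tau> m1" by (auto elim: many_addE)
    from typed_weaken[OF *(3), of "\<Gamma> + \<Delta>2" "n + m2"] True show ?thesis
      by (simp add: * ac_simps)
  next
    case False
    then have "typed (subst (Var i) c u) \<Gamma> \<tau> 0" using Var.prems(1) by (simp add: ins_def split: if_splits)
    from typed_weaken[OF this, of \<Delta> "n + m"] show ?thesis by simp
  qed
next
  case (Lam t)
  from Lam.prems(1) obtain N \<sigma> where *: "\<tau> = Arr N \<sigma>" "typed t (ins (Suc c) M (econs N \<Gamma>)) \<sigma> n"
    by (auto simp: econs_ins)
  have "many (typed (shift (Suc c) 0 u)) M (econs {#} \<Delta>) m"
    using Lam.prems(2) unfolding shift_Suc[symmetric] by (simp only: many_shift)
  from Lam.IH[OF *(2) this] show ?case unfolding * by simp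
next
  case (App t s)
  from App.prems(1) obtain A B n1 n2 N where *: "ins c M \<Gamma> = A + B" "n = Suc (n1 + n2)" "N \<noteq> {#}"
    "typed t A (Arr N \<tau>) n1" "many (typed s) N B n2" by (rule typed_AppE)
  from *(1) obtain M1 M2 \<Gamma>1 \<Gamma>2 where **: "A = ins c M1 \<Gamma>1" "B = ins c M2 \<Gamma>2" "M = M1 + M2" "\<Gamma> = \<Gamma>1 + \<Gamma>2"
    by (rule ins_eq_addE)
  from App.prems(2)[unfolded **] obtain \<Delta>1 \<Delta>2 m1 m2 where ***: "\<Delta> = \<Delta>1 + \<Delta>2" "m = m1 + m2"
    "many (typed (shift c 0 u)) M1 \<Delta>1 m1" "many (typed (shift c 0 u)) M2 \<Delta>2 m2" by (rule many_splitE)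
  from typed_AppI[OF App.IH(1)[OF *(4)[unfolded **] ***(3)] many_subst[OF App.IH(2) *(5)[unfolded **] ***(4)] *(3)]
  show ?case unfolding * ** *** by (simp only: subst.simps ac_simps add_Suc add_Suc_right)
next
  case (Sub t s)
  from Sub.prems(1) obtain A B n1 n2 N where *: "ins c M \<Gamma> = A + B" "n = n1 + n2" "N \<noteq> {#}"
    "typed t (econs N A) \<tau> n1" "many (typed s) N B n2" by (rule typed_SubE)
  from *(1) obtain M1 M2 \<Gamma>1 \<Gamma>2 where **: "A = ins c M1 \<Gamma>1" "B = ins c M2 \<Gamma>2" "M = M1 + M2" "\<Gamma> = \<Gamma>1 + \<Gamma>2"
    by (rule ins_eq_addE)
  from Sub.prems(2)[unfolded **] obtain \<Delta>1 \<Delta>2 m1 m2 where ***: "\<Delta> = \<Delta>1 + \<Delta>2" "m = m1 + m2"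
    "many (typed (shift c 0 u)) M1 \<Delta>1 m1" "many (typed (shift c 0 u)) M2 \<Delta>2 m2" by (rule many_splitE)
  have 1: "typed t (ins (Suc c) M1 (econs N \<Gamma>1)) \<tau> n1" using *(4) by (simp only: ** econs_ins)
  have "many (typed (shift (Suc c) 0 u)) M1 (econs {#} \<Delta>1) m1"
    using ***(3) unfolding shift_Suc[symmetric] by (simp only: many_shift)
  from Sub.IH(1)[OF 1 this] have 2: "typed (subst t (Suc c) u) (econs N (\<Gamma>1 + \<Delta>1)) \<tau> (n1 + m1)" by simp
  from typed_SubI[OF 2 many_subst[OF Sub.IH(2) *(5)[unfolded **] ***(4)] *(3)]
  show ?case unfolding * ** *** by (simp only: subst.simps ac_simps)
qed

definition contract :: "nat \<Rightarrow> env \<Rightarrow> env" where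
  "contract c \<Gamma> i = (if i < c then \<Gamma> i else if i = c then \<Gamma> c + \<Gamma> (Suc c) else \<Gamma> (Suc i))"

lemma contract_add: "contract c (\<Gamma> + \<Delta>) = contract c \<Gamma> + contract c \<Delta>"
  by (auto simp: contract_def fun_eq_iff plus_fun_apply)

lemma contract_econs: "contract (Suc c) (econs M \<Gamma>) = econs M (contract c \<Gamma>)"
proof (rule ext)
  show "contract (Suc c) (econs M \<Gamma>) i = econs M (contract c \<Gamma>) i" for i
    by (cases i) (auto simp: contract_def)
qed

lemma contract_econs_0: "contract 0 (econs M (econs N \<Gamma>)) = econs (M + N) \<Gamma>"
proof (rule ext)
  show "contract 0 (econs M (econs N \<Gamma>)) i = econs (M + N) \<Gamma> i" for i
    by (cases i) (auto simp: contract_def)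
qed

lemma contract_ins:
  "contract c (ins c {#} \<Gamma>) = \<Gamma>" "contract c (ins (Suc c) {#} \<Gamma>) = \<Gamma>"
  by (auto simp: contract_def ins_def fun_eq_iff)

lemma many_merge:
  assumes "\<And>\<Gamma> \<tau> n. typed t' \<Gamma> \<tau> n \<Longrightarrow> \<exists>\<Delta>. contract c \<Delta> = \<Gamma> \<and> typed t \<Delta> \<tau> n"
    and "many (typed t') M \<Gamma> n"
  shows "\<exists>\<Delta>. contract c \<Delta> = \<Gamma> \<and> many (typed t) M \<Delta> n"
  using assms(2)
proof induction
  case (many_empty \<Gamma> n)
  then show ?case using contract_ins many.many_empty by blast
next
  case (many_add \<Gamma> \<sigma> n M \<Delta> m)
  then show ?case by (metis assms(1) contract_add many.many_add)
qed

text \<open>Composing with \<open>merge c\<close> would copy the entry of \<open>c\<close> to both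
  variables, and \<open>u\<close> would have to be typed twice for it. Instead each type goes to the
  variable whose occurrence uses it, so the two entries add up to the old one.\<close>

lemma typed_merge:
  "typed (ren (merge c) t) \<Gamma> \<tau> n \<Longrightarrow> \<exists>\<Delta>. contract c \<Delta> = \<Gamma> \<and> typed t \<Delta> \<tau> n"
proof (induction t arbitrary: c \<Gamma> \<tau> n)
  case (Var i)
  show ?case
  proof (cases "i = Suc c")
    case True
    \<comment> \<open>An empty entry inserted at \<open>c\<close> moves the old one to
      \<open>Suc c\<close>, the variable used here.\<close>
    then show ?thesis using Var
      by (intro exI[of _ "ins c {#} \<Gamma>"]) (auto simp: contract_ins, simp add: ins_def merge_def)
  next
    case False
    then show ?thesis using Var
      by (intro exI[of _ "ins (Suc c) {#} \<Gamma>"]) (auto simp: contract_ins, auto simp add: ins_def merge_def split: if_splits)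
  qed
next
  case (Lam t)
  then obtain M \<sigma> where *: "\<tau> = Arr M \<sigma>" "typed (ren (merge (Suc c)) t) (econs M \<Gamma>) \<sigma> n"
    by (auto simp: lift_merge)
  from Lam.IH[OF *(2)] obtain \<Delta> where "contract (Suc c) \<Delta> = econs M \<Gamma>" "typed t \<Delta> \<sigma> n" by blast
  then show ?case using * by (metis contract_econs econs_cases econs_inject typed_LamI)
next
  case (App t u)
  then have "typed (App (ren (merge c) t) (ren (merge c) u)) \<Gamma> \<tau> n" by simp
  then obtain \<Gamma>1 \<Gamma>2 n1 n2 M where *: "\<Gamma> = \<Gamma>1 + \<Gamma>2" "n = Suc (n1 + n2)" "M \<noteq> {#}"
    "typed (ren (merge c) t) \<Gamma>1 (Arr M \<tau>) n1" "many (typed (ren (merge c) u)) M \<Gamma>2 n2"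
    by (rule typed_AppE)
  from App.IH(1)[OF *(4)] many_merge[OF App.IH(2) *(5)] show ?case
    unfolding * by (metis *(3) contract_add typed_AppI)
next
  case (Sub t u)
  then have "typed (Sub (ren (merge (Suc c)) t) (ren (merge c) u)) \<Gamma> \<tau> n" by (simp add: lift_merge)
  then obtain \<Gamma>1 \<Gamma>2 n1 n2 M where *: "\<Gamma> = \<Gamma>1 + \<Gamma>2" "n = n1 + n2" "M \<noteq> {#}"
    "typed (ren (merge (Suc c)) t) (econs M \<Gamma>1) \<tau> n1" "many (typed (ren (merge c) u)) M \<Gamma>2 n2"
    by (rule typed_SubE)
  from Sub.IH(1)[OF *(4)] obtain \<Delta> where "contract c \<Delta> = \<Gamma>1" "typed t (econs M \<Delta>) \<tau> n1"
    by (metis contract_econs econs_cases econs_inject)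
  with many_merge[OF Sub.IH(2) *(5)] show ?case
    unfolding * by (metis *(3) contract_add typed_SubI)
qed

lemma root_jump_type_le: "root_jump a b \<Longrightarrow> type_le a b"
proof (induction rule: root_jump.induct)
  case (w t u)
  show ?case
    by (rule type_leI, elim typed_SubE) (simp only: typed_shift typed_weaken)
next
  case (d t u)
  show ?case
    by (rule type_leI, elim typed_SubE)
      (metis ins_0 shift_0 typed_subst)
next
  case (c t u)
  show ?case
  proof (rule type_leI)
    fix \<Gamma> \<tau> n
    assume "typed (Sub (ren (merge 0) t) u) \<Gamma> \<tau> n"
    then obtain \<Gamma>1 \<Gamma>2 n1 n2 M where *: "\<Gamma> = \<Gamma>1 + \<Gamma>2" "n = n1 + n2" "M \<noteq> {#}"
      "typed (ren (merge 0) t) (econs M \<Gamma>1) \<tau> n1" "many (typed u) M \<Gamma>2 n2"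
      by (rule typed_SubE)
    from typed_merge[OF *(4)] obtain A B where **: "M = A + B" "typed t (econs A (econs B \<Gamma>1)) \<tau> n1"
      by (metis contract_econs_0 econs_cases econs_inject)
    from *(5)[unfolded **] obtain \<Delta>1 \<Delta>2 m1 m2 where ***: "\<Gamma>2 = \<Delta>1 + \<Delta>2" "n2 = m1 + m2"
      "many (typed u) A \<Delta>1 m1" "many (typed u) B \<Delta>2 m2" by (rule many_splitE)
    \<comment> \<open>Both jumps need a typed argument; they have one because both variables occur
      after the renaming.\<close>
    have ne: "A \<noteq> {#}" "B \<noteq> {#}"
      using typed_occ[OF **(2), of 0] typed_occ[OF **(2), of 1] c by auto
    have "many (typed (shift 1 0 u)) A (econs {#} \<Delta>1) m1"
      using ***(3) by (simp only: many_shift)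
    from typed_SubI[OF **(2) this ne(1)]
    have "typed (Sub t (shift 1 0 u)) (econs B (\<Gamma>1 + \<Delta>1)) \<tau> (n1 + m1)" by simp
    from typed_SubI[OF this ***(4) ne(2)]
    show "typed (Sub (Sub t (shift 1 0 u)) u) \<Gamma> \<tau> n" unfolding * *** by (simp only: ac_simps)
  qed
next
  case (u B t u)
  show ?case by (rule type_le_plug)
qed

section \<open>Rule \<open>dB\<close> lowers the count\<close>

lemma type_le_wrap: "type_le a b \<Longrightarrow> type_le (wrap a L) (wrap b L)"
  by (induction L arbitrary: a b) (auto intro: type_le_SubL)

lemma type_less_wrap: "type_less a b \<Longrightarrow> type_less (wrap a L) (wrap b L)"
  by (induction L arbitrary: a b) (auto intro: type_less_SubL)

text \<open>The jumps between abstraction and argument are crossed one by one with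
  \<open>type_le_appl\<close>; what remains of \<open>dB\<close> is the case of an empty
  list.\<close>

lemma type_le_App_wrap: "type_le (App (wrap s L) u) (wrap (App s (shift (length L) 0 u)) L)"
proof (induction L arbitrary: s)
  case (Cons v L)
  from type_le_trans[OF Cons[of "Sub s v"] type_le_wrap[OF type_le_appl]]
  show ?case unfolding shift_Suc by simp
qed (simp add: type_le_refl)

lemma type_less_beta: "type_less (App (Lam t) u) (Sub t u)"
  unfolding type_less_def
proof (intro allI impI)
  fix \<Gamma> \<tau> n
  assume "typed (App (Lam t) u) \<Gamma> \<tau> n"
  then obtain \<Gamma>1 \<Gamma>2 n1 n2 M where *: "\<Gamma> = \<Gamma>1 + \<Gamma>2" "n = Suc (n1 + n2)" "M \<noteq> {#}"
    "typed t (econs M \<Gamma>1) \<tau> n1" "many (typed u) M \<Gamma>2 n2"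
    by (elim typed_AppE typed_LamE) (metis ty.inject)
  from typed_SubI[OF *(4,5,3)] show "\<exists>m<n. typed (Sub t u) \<Gamma> \<tau> m" unfolding * by blast
qed

lemma root_dB_type_less: "root_dB a b \<Longrightarrow> type_less a b"
proof (induction rule: root_dB.induct)
  case (1 t L u)
  from type_le_App_wrap[of "Lam t" L u] type_less_wrap[OF type_less_beta, of t "shift (length L) 0 u" L]
  show ?case unfolding type_le_def type_less_def by blast
qed

subsection \<open>Typability of strongly normalizing lambda-terms\<close>

text \<open>\<open>M\<close> collects the types at which the copies of \<open>u\<close> are used and
  comes out as \<open>{#}\<close> if there are none. Counts are left open, since only typability is
  wanted.\<close>

lemma typed_subst_rev:
  "is_lambda_term t \<Longrightarrow> typed (subst t c u) \<Gamma> \<tau> n \<Longrightarrow>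
    \<exists>\<Gamma>1 \<Delta> M n1 m. \<Gamma> = \<Gamma>1 + \<Delta> \<and> typed t (ins c M \<Gamma>1) \<tau> n1 \<and> many (typed (shift c 0 u)) M \<Delta> m"
proof (induction t arbitrary: c \<Gamma> \<tau> n)
  case (Var i)
  show ?case
  proof (cases "i = c")
    case True
    with Var have "many (typed (shift c 0 u)) {#\<tau>#} \<Gamma> n"
      by (simp add: many_single typed_weaken)
    with True show ?thesis
      by (intro exI[of _ 0] exI[of _ \<Gamma>] exI[of _ "{#\<tau>#}"] exI[of _ n]) (simp add: ins_def)
  next
    case False
    then have "typed (Var i) (ins c {#} \<Gamma>) \<tau> n" using Var by (auto simp: ins_def split: if_splits)
    then show ?thesis using many_empty[of _ 0 0] by (metis add_0_right)
  qed
next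
  case (Lam t)
  from Lam.prems obtain N \<sigma> where *: "is_lambda_term t" "\<tau> = Arr N \<sigma>"
    "typed (subst t (Suc c) u) (econs N \<Gamma>) \<sigma> n" by auto
  from Lam.IH[OF *(1,3)] obtain \<Gamma>1 \<Delta> M n1 m where **: "econs N \<Gamma> = \<Gamma>1 + \<Delta>"
    "typed t (ins (Suc c) M \<Gamma>1) \<sigma> n1" "many (typed (shift (Suc c) 0 u)) M \<Delta> m" by blast
  from **(1) obtain N1 N2 \<Gamma>2 \<Delta>2 where ***: "\<Gamma>1 = econs N1 \<Gamma>2" "\<Delta> = econs N2 \<Delta>2" "N = N1 + N2" "\<Gamma> = \<Gamma>2 + \<Delta>2"
    by (rule econs_eq_addE)
  have "many (typed (shift c 0 u)) M \<Delta>2 m"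
    using **(3) unfolding shift_Suc[symmetric] ***(2) by (simp only: many_shift)
  moreover have "typed t (econs N (ins c M \<Gamma>2)) \<sigma> n1"
    using typed_weaken[OF **(2), of "econs N2 0" 0] unfolding *** econs_ins[symmetric] by simp
  ultimately show ?case unfolding *(2) ***(4) by (metis typed_LamI)
next
  case (App t s)
  have many: "\<exists>\<Gamma>1 \<Delta> M n1 m. \<Gamma> = \<Gamma>1 + \<Delta> \<and> many (typed s) N (ins c M \<Gamma>1) n1 \<and> many (typed (shift c 0 u)) M \<Delta> m"
    if "many (typed (subst s c u)) N \<Gamma> n" for N \<Gamma> n
    using that
  proof induction
    case (many_empty \<Gamma> n)
    then show ?case by (metis add_0_right many.many_empty)
  next
    case (many_add \<Gamma> \<sigma> n N \<Delta> m)
    from many_add.IH obtain \<Gamma>1 \<Delta>1 M n1 m1 where *: "\<Delta> = \<Gamma>1 + \<Delta>1" "many (typed s) N (ins c M \<Gamma>1) n1"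
      "many (typed (shift c 0 u)) M \<Delta>1 m1" by blast
    from App.IH(2)[OF _ many_add.hyps(1)] App.prems obtain \<Gamma>2 \<Delta>2 K n2 m2 where
      **: "\<Gamma> = \<Gamma>2 + \<Delta>2" "typed s (ins c K \<Gamma>2) \<sigma> n2" "many (typed (shift c 0 u)) K \<Delta>2 m2" by auto
    have "many (typed s) (add_mset \<sigma> N) (ins c (K + M) (\<Gamma>2 + \<Gamma>1)) (n2 + n1)"
      using many.many_add[of "typed s", OF **(2) *(2)] by (simp add: ins_add)
    moreover have "\<Gamma> + \<Delta> = (\<Gamma>2 + \<Gamma>1) + (\<Delta>2 + \<Delta>1)" unfolding * ** by (simp add: ac_simps)
    ultimately show ?case using many_union[OF **(3) *(3)] by blast
  qed
  from App.prems have "typed (App (subst t c u) (subst s c u)) \<Gamma> \<tau> n" by simp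
  then obtain \<Gamma>1 \<Gamma>2 n1 n2 N where *: "\<Gamma> = \<Gamma>1 + \<Gamma>2" "N \<noteq> {#}"
    "typed (subst t c u) \<Gamma>1 (Arr N \<tau>) n1" "many (typed (subst s c u)) N \<Gamma>2 n2" by (rule typed_AppE)
  from App.IH(1)[OF _ *(3)] App.prems obtain \<Gamma>3 \<Delta>1 M n3 m1 where
    **: "\<Gamma>1 = \<Gamma>3 + \<Delta>1" "typed t (ins c M \<Gamma>3) (Arr N \<tau>) n3" "many (typed (shift c 0 u)) M \<Delta>1 m1" by auto
  from many[OF *(4)] obtain \<Gamma>4 \<Delta>2 K n4 m2 where
    ***: "\<Gamma>2 = \<Gamma>4 + \<Delta>2" "many (typed s) N (ins c K \<Gamma>4) n4" "many (typed (shift c 0 u)) K \<Delta>2 m2" by blast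
  have "typed (App t s) (ins c (M + K) (\<Gamma>3 + \<Gamma>4)) \<tau> (Suc (n3 + n4))"
    using typed_AppI[OF **(2) ***(2) *(2)] by (simp only: ins_add)
  moreover have "\<Gamma> = (\<Gamma>3 + \<Gamma>4) + (\<Delta>1 + \<Delta>2)" unfolding * ** *** by (simp add: ac_simps)
  ultimately show ?case using many_union[OF **(3) ***(3)] by blast
qed simp

definition typable :: "jt \<Rightarrow> bool" where
  "typable t \<longleftrightarrow> (\<exists>\<Gamma> \<tau> n. typed t \<Gamma> \<tau> n)"

lemma typed_beta_rev:
  assumes "is_lambda_term t" "typable u" "typed (subst t 0 u) \<Gamma> \<tau> n"
  shows "\<exists>\<Gamma> n. typed (App (Lam t) u) \<Gamma> \<tau> n"
proof -
  from typed_subst_rev[OF assms(1,3)] obtain \<Gamma>1 \<Delta> M n1 m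
    where *: "typed t (econs M \<Gamma>1) \<tau> n1" "many (typed u) M \<Delta> m" by (auto simp: ins_0)
  show ?thesis
  proof (cases "M = {#}")
    case True
    \<comment> \<open>The argument is erased, but an application has to type it. Any type of
      \<open>u\<close> will do, and weakening lets the body ignore it.\<close>
    from assms(2) obtain \<Gamma>2 \<sigma> k where "typed u \<Gamma>2 \<sigma> k" by (auto simp: typable_def)
    then have "many (typed u) {#\<sigma>#} \<Gamma>2 k" by (simp add: many_single typed_weaken)
    moreover have "typed t (econs {#\<sigma>#} \<Gamma>1) \<tau> n1"
      using typed_weaken[OF *(1), of "econs {#\<sigma>#} 0" 0] True by simp
    ultimately show ?thesis by (meson add_mset_not_empty typed_AppI typed_LamI)
  next
    case False
    with * show ?thesis by (meson typed_AppI typed_LamI)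
  qed
qed

text \<open>The type of the head must be kept because it fixes how the arguments are typed;
  environment and count may change, as they are merely added up.\<close>

lemma typed_spine_mono:
  assumes "\<And>\<Gamma> \<tau> n. typed a \<Gamma> \<tau> n \<Longrightarrow> \<exists>\<Gamma> n. typed b \<Gamma> \<tau> n"
  shows "typed (foldl App a ts) \<Gamma> \<tau> n \<Longrightarrow> \<exists>\<Gamma> n. typed (foldl App b ts) \<Gamma> \<tau> n"
proof (induction ts arbitrary: \<Gamma> \<tau> n rule: rev_induct)
  case (snoc v ts)
  then have "typed (App (foldl App a ts) v) \<Gamma> \<tau> n" by simp
  then obtain \<Gamma>1 \<Gamma>2 n1 n2 M where *: "M \<noteq> {#}" "typed (foldl App a ts) \<Gamma>1 (Arr M \<tau>) n1"
    "many (typed v) M \<Gamma>2 n2" by (rule typed_AppE)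
  from snoc.IH[OF *(2)] obtain \<Delta> k where "typed (foldl App b ts) \<Delta> (Arr M \<tau>) k" by blast
  from typed_AppI[OF this *(3,1)] show ?case by (simp del: typed.simps) blast
qed (simp add: assms)

lemma typed_Var_spine:
  "\<forall>t\<in>set ts. typable t \<Longrightarrow> \<exists>\<Gamma> n. typed (foldl App (Var i) ts) \<Gamma> \<tau> n"
proof (induction ts arbitrary: \<tau> rule: rev_induct)
  case Nil
  show ?case by (auto intro!: exI[of _ "\<lambda>_. {#\<tau>#}"])
next
  case (snoc v ts)
  then obtain \<Delta> \<sigma> m where "typed v \<Delta> \<sigma> m" by (auto simp: typable_def)
  then have 1: "many (typed v) {#\<sigma>#} \<Delta> m" by (simp add: many_single typed_weaken)
  from snoc obtain \<Gamma> n where "typed (foldl App (Var i) ts) \<Gamma> (Arr {#\<sigma>#} \<tau>) n" by fastforce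
  from typed_AppI[OF this 1] show ?case by (simp del: typed.simps) blast
qed

section \<open>Induction along beta-reduction\<close>

lemma lambda_term_cases:
  assumes "is_lambda_term t"
  obtains (Var) i ts where "t = foldl App (Var i) ts"
    | (Lam) s where "t = Lam s"
    | (redex) s u ts where "t = foldl App (App (Lam s) u) ts"
proof -
  have "(\<exists>i ts. t = foldl App (Var i) ts) \<or> (\<exists>s. t = Lam s) \<or> (\<exists>s u ts. t = foldl App (App (Lam s) u) ts)"
    using assms
  proof (induction t)
    case (Var i)
    then show ?case by (metis foldl_Nil)
  next
    case (App t v)
    have *: "App (foldl App h ts) v = foldl App h (ts @ [v])" for h ts by simp
    from App.prems have "is_lambda_term t" by simp
    from App.IH(1)[OF this] show ?case by (metis * foldl_Nil)
  qed auto
  then show ?thesis using that by blast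
qed

inductive subterm :: "jt \<Rightarrow> jt \<Rightarrow> bool" where
  subterm_refl: "subterm t t"
| subterm_Lam: "subterm s t \<Longrightarrow> subterm s (Lam t)"
| subterm_AppL: "subterm s t \<Longrightarrow> subterm s (App t u)"
| subterm_AppR: "subterm s u \<Longrightarrow> subterm s (App t u)"

lemma subterm_trans: "subterm s t \<Longrightarrow> subterm r s \<Longrightarrow> subterm r t"
  by (induction rule: subterm.induct) (auto intro: subterm.intros)

lemma subterm_beta: "subterm s t \<Longrightarrow> beta s s' \<Longrightarrow> \<exists>t'. beta t t' \<and> subterm s' t'"
  unfolding beta_def
  by (induction rule: subterm.induct) (blast intro: subterm.intros cc.intros)+

lemma subterm_spine_head: "subterm h (foldl App h ts)"
  by (induction ts rule: rev_induct) (auto intro: subterm.intros)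

lemma subterm_spine_arg: "v \<in> set ts \<Longrightarrow> subterm v (foldl App h ts)"
  by (induction ts rule: rev_induct) (auto intro: subterm.intros)

lemma size_spine_head: "size h \<le> size (foldl App h ts)"
  by (induction ts rule: rev_induct) auto

lemma size_spine_arg: "v \<in> set ts \<Longrightarrow> size v < size (foldl App h ts)"
  by (induction ts rule: rev_induct) auto

lemma is_lambda_term_spine [simp]:
  "is_lambda_term (foldl App h ts) \<longleftrightarrow> is_lambda_term h \<and> (\<forall>t\<in>set ts. is_lambda_term t)"
  by (induction ts rule: rev_induct) auto

lemma is_lambda_term_shift [simp]: "is_lambda_term (shift n c t) = is_lambda_term t"
  by (induction t arbitrary: c) auto

lemma is_lambda_term_subst: "is_lambda_term t \<Longrightarrow> is_lambda_term u \<Longrightarrow> is_lambda_term (subst t c u)"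
  by (induction t arbitrary: c) auto

lemma cc_spine: "cc R a b \<Longrightarrow> cc R (foldl App a ts) (foldl App b ts)"
  by (induction ts rule: rev_induct) (auto intro: cc.intros)

text \<open>Induction on the accessibility of \<open>t\<close>, then on the size of its subterm.
  Speaking of all subterms fits the outer induction: a step in a subterm is a step of
  \<open>t\<close>, whose reduct contains the reduced subterm.\<close>

lemma subterm_typable:
  assumes "t \<in> Wellfounded.acc {(b, a). beta a b}"
  shows "\<forall>s. subterm s t \<longrightarrow> is_lambda_term s \<longrightarrow> typable s"
  using assms
proof (rule acc_induct, intro allI impI)
  fix t s
  assume IH: "\<forall>t'. (t', t) \<in> {(b, a). beta a b} \<longrightarrow>
      (\<forall>s. subterm s t' \<longrightarrow> is_lambda_term s \<longrightarrow> typable s)"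
    and "subterm s t" "is_lambda_term s"
  from this(2,3) show "typable s"
  proof (induction "size s" arbitrary: s rule: less_induct)
    case less
    have sub: "typable r" if "subterm r s" "size r < size s" "is_lambda_term r" for r
      using less that subterm_trans by blast
    from less.prems(2) show ?case
    proof (cases rule: lambda_term_cases)
      case (Var i ts)
      then have "\<forall>r\<in>set ts. typable r"
        using sub subterm_spine_arg size_spine_arg less.prems(2) by auto
      from typed_Var_spine[OF this] show ?thesis unfolding Var typable_def by blast
    next
      case (Lam r)
      then have "typable r" using sub[of r] less.prems(2) by (auto intro: subterm.intros)
      then show ?thesis unfolding Lam typable_def by (metis econs_cases typed_LamI)
    next
      case (redex r u ts)
      let ?s' = "foldl App (subst r 0 u) ts"
      have "beta s ?s'" unfolding redex beta_def
        by (intro cc_spine cc_root root_beta.intros)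
      then obtain t' where t': "beta t t'" "subterm ?s' t'"
        using subterm_beta less.prems(1) by blast
      have lam: "is_lambda_term r" "is_lambda_term u" "is_lambda_term ?s'"
        using less.prems(2) by (auto simp: redex is_lambda_term_subst)
      have "typable ?s'" using IH t' lam(3) by blast
      moreover have "subterm u s" unfolding redex
        using subterm_trans[OF subterm_spine_head] subterm_AppR[OF subterm_refl] by blast
      \<comment> \<open>The contraction may have erased \<open>u\<close>, so its typability comes
        from the inner induction on size.\<close>
      then have "typable u" using sub[of u] lam(2) size_spine_head[of "App (Lam r) u" ts] by (simp add: redex)
      ultimately obtain \<Gamma> \<tau> n where u: "typable u" and s': "typed ?s' \<Gamma> \<tau> n"
        unfolding typable_def by blast
      from s' have "\<exists>\<Gamma> n. typed (foldl App (App (Lam r) u) ts) \<Gamma> \<tau> n"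
        by (rule typed_spine_mono[rotated]) (rule typed_beta_rev[OF lam(1) u])
      then show ?thesis unfolding redex typable_def by blast
    qed
  qed
qed

text \<open>Lexicographic induction on \<open>n\<close> and \<open>jm t\<close>: a
  \<open>dB\<close>-step may raise \<open>jm\<close> but lowers the bound; the other steps keep the
  bound and lower \<open>jm\<close>.\<close>

lemma typed_acc:
  "typed t \<Gamma> \<tau> n \<Longrightarrow> t \<in> Wellfounded.acc {(b, a). lju_mod_obox a b}"
proof (induction n arbitrary: t rule: less_induct)
  case (less n)
  note outer = less.IH
  from less.prems show ?case
  proof (induction "jm t" arbitrary: t rule: less_induct)
    case less
    show ?case
    proof (rule accI, clarify)
      fix b
      assume "lju_mod_obox t b"
      then obtain t' u' where *: "obox_eq t t'" "lju t' u'" "obox_eq u' b"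
        by (auto simp: lju_mod_obox_def)
      have t': "typed t' \<Gamma> \<tau> n" using obox_eq_type_le[OF *(1)] less.prems by (auto dest: type_leD)
      have b: "type_le u' b" using obox_eq_type_le[OF *(3)] ..
      from cc_lju_cases[OF *(2)] show "b \<in> Wellfounded.acc {(b, a). lju_mod_obox a b}"
      proof
        assume "cc root_dB t' u'"
        then have "type_less t' u'" by (rule cc_type_less) (rule root_dB_type_less)
        then obtain m where "m < n" "typed u' \<Gamma> \<tau> m" using t' unfolding type_less_def by blast
        then show ?thesis using outer type_leD[OF b] by blast
      next
        assume ju: "cc root_jump t' u'"
        then have "type_le t' u'" by (rule cc_type_le) (rule root_jump_type_le)
        then have "typed b \<Gamma> \<tau> n" using t' b by (blast dest: type_leD)
        moreover have "jm b < jm t"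
          using cc_jump_jm[OF ju] obox_eq_jm[OF *(1)] obox_eq_jm[OF *(3)] by simp
        ultimately show ?thesis using less.hyps by blast
      qed
    qed
  qed
qed

theorem theorem50:
  assumes "is_lambda_term t" and "SN beta t"
  shows "SN lju_mod_obox t"
proof -
  have "typable t"
    using subterm_typable subterm_refl assms unfolding SN_def by blast
  then show ?thesis unfolding SN_def typable_def using typed_acc by blast
qed

end
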